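(* Let $d$ be a positive integer and let $G*o$ be a coning of a finite simple graph $G$. Then $c_{d}(G*o) = c_{d}^*(G*o)$, where $c_d$ denotes the $d$-realisation number and $c_d^*$ denotes the spherical $d$-realisation number.
   Context: Graphs $G=(V,E)$ are finite and simple. The cone $G*o$ of $G$ by a new vertex $o\notin V$ is the graph with vertex set $V\cup\{o\}$ and edge set $E\cup\{ov:v\in V\}$. For $x\in\mathbb{C}^n$ write $[x]_i$ for its $i$-th coordinate, $x\cdot y=\sum_i [x]_i[y]_i$ (bilinear, no conjugation) and $\|x\|^2 = x\cdot x$ (a complex-valued quadratic form). $O(n,\mathbb{C})$ is the group of complex $n\times n$ matrices $M$ with $M^TM=MM^T=I$. A property holds for a general point of an irreducible algebraic set if it holds on some non-empty Zariski open subset. Infinite cardinalities are all identified with $\infty$. $d$-realisation number (for any positive integer $d$ and graph $G=(V,E)$). Let $f_{G,d}:(\mathbb{C}^d)^V\to\mathbb{C}^E$, $p\mapsto(\tfrac12\|p_v-p_w\|^2)_{vw\in E}$. Two realisations $p,q\in(\mathbb{C}^d)^V$ are congruent ($p\sim q$) if there are $A\in O(d,\mathbb{C})$ and $x\in\mathbb{C}^d$ with $p_v=Aq_v+x$ for all $v\in V$. Let $C_d(G,p):=f_{G,d}^{-1}(f_{G,d}(p))/_\sim$. If $|V|\ge d+1$, then $c_d(G):=|C_d(G,p)|$ for a general $p\in(\mathbb{C}^d)^V$ (this value in $\mathbb{N}\cup\{\infty\}$ is constant on a non-empty Zariski open set). If $|V|\le d$, then $c_d(G):=1$ if $G$ is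 complete and $c_d(G):=\infty$ otherwise. Spherical $d$-realisation number. Let $\mathbb{S}^d_{\mathbb{C}}:=\{x\in\mathbb{C}^{d+1}:\|x\|^2=1\}$ and $s_{G,d}:(\mathbb{S}^d_{\mathbb{C}})^V\to\mathbb{C}^E$, $p\mapsto(\tfrac12\|p_v-p_w\|^2)_{vw\in E}$. Two spherical realisations $p,q\in(\mathbb{S}^d_{\mathbb{C}})^V$ are congruent if there is $A\in O(d+1,\mathbb{C})$ with $p_v=Aq_v$ for all $v\in V$. Let $C^*_d(G,p):=s_{G,d}^{-1}(s_{G,d}(p))/_\sim$. If $|V|\ge d+1$, then $c^*_d(G):=|C^*_d(G,p)|$ for a general $p\in(\mathbb{S}^d_{\mathbb{C}})^V$ (again constant on a non-empty Zariski open set). If $|V|\le d$, then $c_d^*(G):=1$ if $G$ is complete and $c_d^*(G):=\infty$ otherwise. *)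

theory Defs
  imports Complex_Main "HOL-Library.Extended_Nat" "HOL-Library.FuncSet"
    "Jordan_Normal_Form.Matrix"
begin

definition finite_simple_graph :: "'v set \<Rightarrow> 'v set set \<Rightarrow> bool" where
  "finite_simple_graph V E \<longleftrightarrow> finite V \<and> (\<forall>e\<in>E. e \<subseteq> V \<and> card e = 2)"

definition complete_graph :: "'v set \<Rightarrow> 'v set set \<Rightarrow> bool" where
  "complete_graph V E \<longleftrightarrow> E = {e. e \<subseteq> V \<and> card e = 2}"

definition cone_verts :: "'v set \<Rightarrow> 'v \<Rightarrow> 'v set" where
  "cone_verts V a = insert a V"

definition cone_edges :: "'v set \<Rightarrow> 'v set set \<Rightarrow> 'v \<Rightarrow> 'v set set" where
  "cone_edges V E a = E \<union> {{a, v} |v. v \<in> V}"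

text \<open>Points of complex affine n-space are the elements of \<^term>\<open>carrier_vec n\<close>; the scalar
  product of complex vectors used here is bilinear (no conjugation), so \<open>sqn\<close> is
  complex-valued.\<close>

definition sqn :: "complex vec \<Rightarrow> complex" where
  "sqn x = x \<bullet> x"

definition complex_orthogonal_group :: "nat \<Rightarrow> complex mat set" where
  "complex_orthogonal_group n =
    {A \<in> carrier_mat n n. A\<^sup>T * A = 1\<^sub>m n \<and> A * A\<^sup>T = 1\<^sub>m n}"

definition complex_sphere :: "nat \<Rightarrow> complex vec set" where
  "complex_sphere d = {x \<in> carrier_vec (d + 1). sqn x = 1}"

definition realisations :: "nat \<Rightarrow> 'v set \<Rightarrow> ('v \<Rightarrow> complex vec) set" where
  "realisations d V = V \<rightarrow>\<^sub>E carrier_vec d"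

definition spherical_realisations :: "nat \<Rightarrow> 'v set \<Rightarrow> ('v \<Rightarrow> complex vec) set" where
  "spherical_realisations d V = V \<rightarrow>\<^sub>E complex_sphere d"

text \<open>The value does not depend on the order in which the ends of \<open>e\<close> are named, see
  \<open>edge_measurement_pair\<close>.\<close>

definition edge_measurement :: "('v \<Rightarrow> complex vec) \<Rightarrow> 'v set \<Rightarrow> complex" where
  "edge_measurement p e = (THE c. \<exists>v w. e = {v, w} \<and> c = 1/2 * sqn (p v - p w))"

lemma sqn_minus_commute:
  assumes "x \<in> carrier_vec n" "y \<in> carrier_vec n"
  shows "sqn (x - y) = sqn (y - x)"
  using assms by (auto simp: sqn_def scalar_prod_def algebra_simps intro!: sum.cong)

lemma edge_measurement_pair:
  assumes "p v \<in> carrier_vec n" "p w \<in> carrier_vec n"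
  shows "edge_measurement p {v, w} = 1/2 * sqn (p v - p w)"
  unfolding edge_measurement_def
  by (rule the_equality) (use sqn_minus_commute[OF assms] in \<open>auto simp: doubleton_eq_iff\<close>)

text \<open>The maps \<open>f\<close> and \<open>s\<close> of the Euclidean and of the spherical setting are both given by this
  formula, on \<^const>\<open>realisations\<close> and on \<^const>\<open>spherical_realisations\<close> respectively.\<close>

definition measurement_map ::
    "'v set set \<Rightarrow> ('v \<Rightarrow> complex vec) \<Rightarrow> ('v set \<Rightarrow> complex)" where
  "measurement_map E p = (\<lambda>e\<in>E. edge_measurement p e)"

definition congruence :: "nat \<Rightarrow> 'v set \<Rightarrow> (('v \<Rightarrow> complex vec) \<times> ('v \<Rightarrow> complex vec)) set" where
  "congruence d V = {(p, q). p \<in> realisations d V \<and> q \<in> realisations d V \<and>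
    (\<exists>A \<in> complex_orthogonal_group d. \<exists>x \<in> carrier_vec d. \<forall>v\<in>V. p v = A *\<^sub>v q v + x)}"

definition spherical_congruence ::
    "nat \<Rightarrow> 'v set \<Rightarrow> (('v \<Rightarrow> complex vec) \<times> ('v \<Rightarrow> complex vec)) set" where
  "spherical_congruence d V =
    {(p, q). p \<in> spherical_realisations d V \<and> q \<in> spherical_realisations d V \<and>
      (\<exists>A \<in> complex_orthogonal_group (d + 1). \<forall>v\<in>V. p v = A *\<^sub>v q v)}"

definition realisation_classes ::
    "nat \<Rightarrow> 'v set \<Rightarrow> 'v set set \<Rightarrow> ('v \<Rightarrow> complex vec) \<Rightarrow> ('v \<Rightarrow> complex vec) set set" where
  "realisation_classes d V E p =
    {q \<in> realisations d V. measurement_map E q = measurement_map E p} // congruence d V"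

definition spherical_realisation_classes ::
    "nat \<Rightarrow> 'v set \<Rightarrow> 'v set set \<Rightarrow> ('v \<Rightarrow> complex vec) \<Rightarrow> ('v \<Rightarrow> complex vec) set set" where
  "spherical_realisation_classes d V E p =
    {q \<in> spherical_realisations d V. measurement_map E q = measurement_map E p}
      // spherical_congruence d V"

definition ecard :: "'a set \<Rightarrow> enat" where
  "ecard A = (if finite A then enat (card A) else \<infinity>)"

text \<open>Polynomial functions in the coordinates \<open>p v $ i\<close>, for \<open>v \<in> V\<close> and \<open>i < n\<close>, of the space of
  families of n-dimensional vectors indexed by \<open>V\<close>.\<close>

inductive_set polynomial_functions ::
    "nat \<Rightarrow> 'v set \<Rightarrow> (('v \<Rightarrow> complex vec) \<Rightarrow> complex) set"
  for n :: nat and V :: "'v set" where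
  const: "(\<lambda>p. c) \<in> polynomial_functions n V"
| coord: "v \<in> V \<Longrightarrow> i < n \<Longrightarrow> (\<lambda>p. p v $ i) \<in> polynomial_functions n V"
| add: "f \<in> polynomial_functions n V \<Longrightarrow> g \<in> polynomial_functions n V \<Longrightarrow>
    (\<lambda>p. f p + g p) \<in> polynomial_functions n V"
| mult: "f \<in> polynomial_functions n V \<Longrightarrow> g \<in> polynomial_functions n V \<Longrightarrow>
    (\<lambda>p. f p * g p) \<in> polynomial_functions n V"

text \<open>\<open>U\<close> is open in the subspace \<open>X\<close>: its complement in \<open>X\<close> is the set of common zeros of
  a family of polynomial functions.\<close>

definition zariski_open_in ::
    "nat \<Rightarrow> 'v set \<Rightarrow> ('v \<Rightarrow> complex vec) set \<Rightarrow> ('v \<Rightarrow> complex vec) set \<Rightarrow> bool" where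
  "zariski_open_in n V X U \<longleftrightarrow>
    (\<exists>F \<subseteq> polynomial_functions n V. U = X - {p \<in> X. \<forall>f\<in>F. f p = 0})"

definition holds_generally ::
    "nat \<Rightarrow> 'v set \<Rightarrow> ('v \<Rightarrow> complex vec) set \<Rightarrow> (('v \<Rightarrow> complex vec) \<Rightarrow> bool) \<Rightarrow> bool" where
  "holds_generally n V X P \<longleftrightarrow>
    (\<exists>U. zariski_open_in n V X U \<and> U \<noteq> {} \<and> (\<forall>p\<in>U. P p))"

text \<open>In the next two definitions the general value exists by the constancy on a non-empty
  Zariski open set, and it is unique because the spaces of realisations are irreducible
  (for \<open>d > 0\<close> in the spherical case).\<close>

definition realisation_number :: "nat \<Rightarrow> 'v set \<Rightarrow> 'v set set \<Rightarrow> enat" where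
  "realisation_number d V E =
    (if card V \<ge> d + 1
     then THE k. holds_generally d V (realisations d V)
            (\<lambda>p. ecard (realisation_classes d V E p) = k)
     else if complete_graph V E then 1 else \<infinity>)"

definition spherical_realisation_number :: "nat \<Rightarrow> 'v set \<Rightarrow> 'v set set \<Rightarrow> enat" where
  "spherical_realisation_number d V E =
    (if card V \<ge> d + 1
     then THE k. holds_generally (d + 1) V (spherical_realisations d V)
            (\<lambda>p. ecard (spherical_realisation_classes d V E p) = k)
     else if complete_graph V E then 1 else \<infinity>)"

end

theory Submission
  imports Defs "Jordan_Normal_Form.Determinant"
begin

text \<open>
  Put the apex of the cone at the origin in a Euclidean realisation \<open>x\<close>, and at the pole
  \<open>(0, 1)\<close> of \<open>\<complex>\<^sup>d \<times> \<complex>\<close> in a spherical realisation \<open>p\<close>. Writing \<open>p v = (x v, t v)\<close>, the point \<open>p v\<close> lies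
  on the sphere iff \<open>(t v)\<^sup>2 = 1 - sqn (x v)\<close>, and the length of the spoke at \<open>v\<close> determines \<open>t v\<close> in the
  spherical case and \<open>sqn (x v)\<close> in the Euclidean case. Hence the heights \<open>t\<close> are constant on the
  spherical fibre, and, as the squared distances satisfy
  \<open>sqn (p v - p w) = sqn (x v - x w) + (t v - t w)\<^sup>2\<close>, forgetting the heights identifies the spherical
  fibre of \<open>p\<close> with the Euclidean fibre of \<open>x\<close>. The congruences that remain are \<open>O(d, \<complex>)\<close> on both sides,
  because an orthogonal map fixing the pole acts on the first \<open>d\<close> coordinates only. So \<open>p\<close> and \<open>x\<close> have
  equally many classes (\<open>ecard_realisation_classes_suspension\<close>), for every \<open>x\<close> and every choice of roots
  \<open>t\<close>; and every spherical realisation is congruent to one with apex at the pole.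

  It remains to see that a value \<open>k\<close> is taken generally by one count iff it is taken generally by the
  other. From the sphere to \<open>\<complex>\<^sup>d\<close>, a polynomial in \<open>x\<close> and the roots \<open>t\<close> has to be replaced by one in \<open>x\<close>
  alone such that, where it is non-zero, the original is non-zero for a suitable choice of signs
  (\<open>eliminate_square_roots\<close>). From \<open>\<complex>\<^sup>d\<close> to the sphere, a Householder reflection moves the apex to the
  pole; it depends rationally on the apex, and its denominators are cleared
  (\<open>function_algebra_fractions\<close>).
\<close>

section \<open>Counting equivalence classes\<close>

lemma ecard_bij_betw:
  assumes "bij_betw h A B"
  shows "ecard A = ecard B"
  using bij_betw_finite[OF assms] bij_betw_same_card[OF assms] by (simp add: ecard_def)

text \<open>Used for the map that takes a realisation to its class and the map that takes it to the class
  of its image.\<close>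

lemma bij_betw_images_same_kernel:
  assumes "\<And>x y. x \<in> A \<Longrightarrow> y \<in> A \<Longrightarrow> F x = F y \<longleftrightarrow> G x = G y"
  shows "bij_betw (G \<circ> inv_into A F) (F ` A) (G ` A)"
proof -
  have eq: "(G \<circ> inv_into A F) (F x) = G x" if "x \<in> A" for x
    using assms[of "inv_into A F (F x)" x] that
    by (simp add: f_inv_into_f inv_into_into)
  show ?thesis
    unfolding bij_betw_def
  proof
    show "inj_on (G \<circ> inv_into A F) (F ` A)"
      using eq assms by (intro inj_onI) auto
    show "(G \<circ> inv_into A F) ` F ` A = G ` A"
      using eq by (auto simp: image_iff)
  qed
qed

text \<open>Both sets of classes are images of \<open>A\<close>, under \<open>q \<mapsto> r `` {q}\<close> and \<open>q \<mapsto> s `` {\<phi> q}\<close>, and these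
  two maps identify the same pairs.\<close>

lemma ecard_quotient_transfer:
  assumes r: "equiv X r" and s: "equiv Y s" and A: "A \<subseteq> X" and B: "B \<subseteq> Y"
    and \<phi>: "\<And>q. q \<in> A \<Longrightarrow> \<phi> q \<in> B"
    and iff: "\<And>q q'. q \<in> A \<Longrightarrow> q' \<in> A \<Longrightarrow> (q, q') \<in> r \<longleftrightarrow> (\<phi> q, \<phi> q') \<in> s"
    and surj: "\<And>b. b \<in> B \<Longrightarrow> \<exists>q\<in>A. (\<phi> q, b) \<in> s"
  shows "ecard (A // r) = ecard (B // s)"
proof -
  have "A // r = (\<lambda>q. r `` {q}) ` A"
    by (auto simp: quotient_def)
  moreover have "B // s = (\<lambda>q. s `` {\<phi> q}) ` A"
  proof
    show "B // s \<subseteq> (\<lambda>q. s `` {\<phi> q}) ` A"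
    proof
      fix C assume "C \<in> B // s"
      then obtain b where b: "b \<in> B" "C = s `` {b}" by (auto simp: quotient_def)
      with surj obtain q where "q \<in> A" "(\<phi> q, b) \<in> s" by blast
      then show "C \<in> (\<lambda>q. s `` {\<phi> q}) ` A"
        using b equiv_class_eq[OF s] by blast
    qed
    show "(\<lambda>q. s `` {\<phi> q}) ` A \<subseteq> B // s"
      using \<phi> by (auto simp: quotient_def)
  qed
  moreover have "r `` {q} = r `` {q'} \<longleftrightarrow> s `` {\<phi> q} = s `` {\<phi> q'}" if "q \<in> A" "q' \<in> A" for q q'
  proof -
    have "q \<in> X" "q' \<in> X" "\<phi> q \<in> Y" "\<phi> q' \<in> Y"
      using that A B \<phi> by auto
    then show ?thesis
      using iff[OF that] by (simp add: eq_equiv_class_iff[OF r] eq_equiv_class_iff[OF s])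
  qed
  ultimately show ?thesis
    using bij_betw_images_same_kernel[of A "\<lambda>q. r `` {q}" "\<lambda>q. s `` {\<phi> q}"]
      ecard_bij_betw by metis
qed

section \<open>The complex orthogonal group\<close>

lemma orthogonal_carrier: "A \<in> complex_orthogonal_group n \<Longrightarrow> A \<in> carrier_mat n n"
  by (simp add: complex_orthogonal_group_def)

lemma orthogonalI:
  assumes "A \<in> carrier_mat n n" "A\<^sup>T * A = 1\<^sub>m n"
  shows "A \<in> complex_orthogonal_group n"
  using assms mat_mult_left_right_inverse[of "A\<^sup>T" n A]
  by (simp add: complex_orthogonal_group_def)

lemma orthogonal_one: "1\<^sub>m n \<in> complex_orthogonal_group n"
  by (simp add: complex_orthogonal_group_def)

lemma orthogonal_transpose:
  "A \<in> complex_orthogonal_group n \<Longrightarrow> A\<^sup>T \<in> complex_orthogonal_group n"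
  by (auto simp: complex_orthogonal_group_def)

lemma orthogonal_transpose_cancel:
  assumes "A \<in> complex_orthogonal_group n" "x \<in> carrier_vec n"
  shows "A\<^sup>T *\<^sub>v (A *\<^sub>v x) = x" "A *\<^sub>v (A\<^sup>T *\<^sub>v x) = x"
  using assms by (auto simp: complex_orthogonal_group_def assoc_mult_mat_vec[symmetric]
      simp del: assoc_mult_mat_vec)

lemma orthogonal_mult:
  assumes A: "A \<in> complex_orthogonal_group n" and B: "B \<in> complex_orthogonal_group n"
  shows "A * B \<in> complex_orthogonal_group n"
proof (rule orthogonalI)
  have [simp]: "A \<in> carrier_mat n n" "B \<in> carrier_mat n n"
    using A B by (blast dest: orthogonal_carrier)+
  show [simp]: "A * B \<in> carrier_mat n n"
    using A B by (intro mult_carrier_mat[of A n n B n] orthogonal_carrier)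
  have "(A * B)\<^sup>T * (A * B) = B\<^sup>T * A\<^sup>T * (A * B)"
    by (simp add: transpose_mult[of A n n B n])
  also have "\<dots> = B\<^sup>T * (A\<^sup>T * (A * B))"
    by (intro assoc_mult_mat[of _ n n _ n _ n]) auto
  also have "A\<^sup>T * (A * B) = (A\<^sup>T * A) * B"
    by (intro assoc_mult_mat[of _ n n _ n _ n, symmetric]) auto
  also have "\<dots> = B" using A by (simp add: complex_orthogonal_group_def left_mult_one_mat[of B n n])
  also have "B\<^sup>T * B = 1\<^sub>m n" using B by (simp add: complex_orthogonal_group_def)
  finally show "(A * B)\<^sup>T * (A * B) = 1\<^sub>m n" .
qed

lemma sqn_orthogonal:
  assumes A: "A \<in> complex_orthogonal_group n" and x: "x \<in> carrier_vec n"
  shows "sqn (A *\<^sub>v x) = sqn x"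
proof -
  have [simp]: "A \<in> carrier_mat n n" using A by (rule orthogonal_carrier)
  have "sqn (A *\<^sub>v x) = (A\<^sup>T *\<^sub>v (A *\<^sub>v x)) \<bullet> x"
    unfolding sqn_def using x
    by (intro transpose_vec_mult_scalar[of A n n x, symmetric] mult_mat_vec_carrier[of _ n n]) simp_all
  then show ?thesis by (simp add: orthogonal_transpose_cancel[OF A x] sqn_def)
qed

text \<open>The reflection in the hyperplane orthogonal to \<open>w\<close>, for the bilinear form; meaningful
  only if \<open>w\<close> is not isotropic.\<close>

definition householder :: "complex vec \<Rightarrow> complex mat" where
  "householder w = mat (dim_vec w) (dim_vec w)
    (\<lambda>(i, j). (if i = j then 1 else 0) - 2 / sqn w * (w $ i * w $ j))"

lemma householder_apply:
  assumes w: "w \<in> carrier_vec n" and x: "x \<in> carrier_vec n" and i: "i < n"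
  shows "(householder w *\<^sub>v x) $ i = x $ i - 2 / sqn w * (w \<bullet> x) * w $ i"
proof -
  have "(householder w *\<^sub>v x) $ i =
      (\<Sum>j<n. ((if i = j then 1 else 0) - 2 / sqn w * (w $ i * w $ j)) * x $ j)"
    using assms by (simp add: householder_def scalar_prod_def atLeast0LessThan)
  also have "\<dots> = (\<Sum>j<n. (if i = j then x $ j else 0) - 2 / sqn w * w $ i * (w $ j * x $ j))"
    by (intro sum.cong) (auto simp: algebra_simps)
  also have "\<dots> = x $ i - 2 / sqn w * w $ i * (\<Sum>j<n. w $ j * x $ j)"
    using i by (simp add: sum_subtractf sum_distrib_left)
  finally show ?thesis
    using x by (simp add: scalar_prod_def atLeast0LessThan mult_ac)
qed

lemma householder_orthogonal:
  assumes w: "w \<in> carrier_vec n" and nz: "sqn w \<noteq> 0"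
  shows "householder w \<in> complex_orthogonal_group n"
proof (rule orthogonalI)
  show c: "householder w \<in> carrier_mat n n" using w by (simp add: householder_def)
  have sym: "(householder w)\<^sup>T = householder w"
    using w by (intro eq_matI) (auto simp: householder_def mult_ac)
  have sq: "(\<Sum>k<n. w $ k * w $ k) = sqn w"
    using w by (simp add: sqn_def scalar_prod_def atLeast0LessThan)
  have "(householder w * householder w) $$ (i, j) = (if i = j then 1 else 0)"
    if ij: "i < n" "j < n" for i j
  proof -
    define c where "c = 2 / sqn w"
    have cs: "c * c * sqn w = 2 * c" using nz by (simp add: c_def field_simps)
    have "(householder w * householder w) $$ (i, j) =
        (\<Sum>k<n. ((if i = k then 1 else 0) - c * (w $ i * w $ k)) *
                 ((if k = j then 1 else 0) - c * (w $ k * w $ j)))"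
      using w ij by (simp add: householder_def scalar_prod_def atLeast0LessThan c_def)
    also have "\<dots> = (\<Sum>k<n. (if i = k then (if k = j then 1 else 0) else 0)
        - (if i = k then c * (w $ k * w $ j) else 0) - (if k = j then c * (w $ i * w $ k) else 0)
        + c * c * w $ i * w $ j * (w $ k * w $ k))"
      by (intro sum.cong) (auto simp: algebra_simps)
    also have "\<dots> = (if i = j then 1 else 0) - c * (w $ i * w $ j) - c * (w $ i * w $ j)
        + c * c * w $ i * w $ j * sqn w"
      using ij by (simp add: sum.distrib sum_subtractf sum_distrib_left[symmetric] sq)
    also have "\<dots> = (if i = j then 1 else 0) + (c * c * sqn w - 2 * c) * (w $ i * w $ j)"
      by (simp add: algebra_simps)
    finally show ?thesis by (simp add: cs)
  qed
  then show "(householder w)\<^sup>T * householder w = 1\<^sub>m n"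
    unfolding sym using c by (intro eq_matI) auto
qed

section \<open>Adding a coordinate\<close>

text \<open>The ambient space of the sphere is split as \<open>\<complex>\<^sup>d \<times> \<complex>\<close>; the last coordinate is called the
  height.\<close>

definition snoc :: "complex vec \<Rightarrow> complex \<Rightarrow> complex vec" where
  "snoc x t = x @\<^sub>v vec 1 (\<lambda>_. t)"

abbreviation pole :: "nat \<Rightarrow> complex vec" where
  "pole d \<equiv> snoc (0\<^sub>v d) 1"

lemma snoc_carrier: "x \<in> carrier_vec d \<Longrightarrow> snoc x t \<in> carrier_vec (Suc d)"
  by (rule carrier_vecI) (simp add: snoc_def)

lemma dim_snoc [simp]: "dim_vec (snoc x t) = Suc (dim_vec x)"
  by (simp add: snoc_def)

lemma snoc_index:
  "x \<in> carrier_vec d \<Longrightarrow> i < Suc d \<Longrightarrow> snoc x t $ i = (if i < d then x $ i else t)"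
  by (auto simp: snoc_def)

lemma pole_carrier: "pole d \<in> carrier_vec (Suc d)"
  by (simp add: snoc_carrier)

lemma pole_index: "i < Suc d \<Longrightarrow> pole d $ i = (if i < d then 0 else 1)"
  by (simp add: snoc_index[of _ d])

lemma snoc_eq_iff:
  assumes "x \<in> carrier_vec d" "y \<in> carrier_vec d"
  shows "snoc x s = snoc y t \<longleftrightarrow> x = y \<and> s = t"
  unfolding snoc_def using append_vec_eq[OF assms] by (auto dest: arg_cong[of _ _ "\<lambda>v. v $ 0"])

lemma snoc_vec_first:
  "z \<in> carrier_vec (Suc d) \<Longrightarrow> snoc (vec_first z d) (z $ d) = z"
  by (intro eq_vecI) (auto simp: snoc_index vec_first_def less_Suc_eq)

lemma scalar_prod_snoc:
  "x \<in> carrier_vec d \<Longrightarrow> y \<in> carrier_vec d \<Longrightarrow> snoc x s \<bullet> snoc y t = x \<bullet> y + s * t"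
  unfolding snoc_def by (subst scalar_prod_append[of _ d _ 1]) (auto simp: scalar_prod_def)

lemma sqn_snoc: "x \<in> carrier_vec d \<Longrightarrow> sqn (snoc x t) = sqn x + t\<^sup>2"
  by (simp add: sqn_def scalar_prod_snoc power2_eq_square)

lemma snoc_diff:
  "x \<in> carrier_vec d \<Longrightarrow> y \<in> carrier_vec d \<Longrightarrow> snoc x s - snoc y t = snoc (x - y) (s - t)"
  by (intro eq_vecI) (auto simp: snoc_index[of _ d])

definition extend_orthogonal :: "nat \<Rightarrow> complex mat \<Rightarrow> complex mat" where
  "extend_orthogonal d A = four_block_mat A (0\<^sub>m d 1) (0\<^sub>m 1 d) (1\<^sub>m 1)"

lemma extend_orthogonal_snoc:
  assumes "A \<in> carrier_mat d d" "x \<in> carrier_vec d"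
  shows "extend_orthogonal d A *\<^sub>v snoc x t = snoc (A *\<^sub>v x) t"
  using assms by (simp add: extend_orthogonal_def snoc_def mult_mat_vec_split)

lemma extend_orthogonal_mem_iff:
  assumes A: "A \<in> carrier_mat d d"
  shows "extend_orthogonal d A \<in> complex_orthogonal_group (Suc d) \<longleftrightarrow>
    A \<in> complex_orthogonal_group d"
proof -
  let ?M = "extend_orthogonal d A"
  have c: "?M \<in> carrier_mat (Suc d) (Suc d)"
    using four_block_carrier_mat[OF A one_carrier_mat[of 1], of "0\<^sub>m d 1" "0\<^sub>m 1 d"]
    by (simp add: extend_orthogonal_def)
  have t: "?M\<^sup>T = four_block_mat (A\<^sup>T) (0\<^sub>m d 1) (0\<^sub>m 1 d) (1\<^sub>m 1)"
    unfolding extend_orthogonal_def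
    by (subst transpose_four_block_mat[OF A]) (auto simp: transpose_one)
  have m: "?M\<^sup>T * ?M = four_block_mat (A\<^sup>T * A) (0\<^sub>m d 1) (0\<^sub>m 1 d) (1\<^sub>m 1)"
    unfolding t unfolding extend_orthogonal_def using A
    by (subst mult_four_block_mat[of _ d d _ 1 _ 1 _ _ d _ 1]) auto
  show ?thesis
  proof
    assume "?M \<in> complex_orthogonal_group (Suc d)"
    then have eq: "four_block_mat (A\<^sup>T * A) (0\<^sub>m d 1) (0\<^sub>m 1 d) (1\<^sub>m 1) = 1\<^sub>m (Suc d)"
      by (simp add: complex_orthogonal_group_def m)
    have "A\<^sup>T * A = 1\<^sub>m d"
    proof (rule eq_matI)
      fix i j assume ij: "i < dim_row (1\<^sub>m d)" "j < dim_col (1\<^sub>m d)"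
      then show "(A\<^sup>T * A) $$ (i, j) = 1\<^sub>m d $$ (i, j)"
        using arg_cong[OF eq, of "\<lambda>B. B $$ (i, j)"] A by simp
    qed (use A in auto)
    then show "A \<in> complex_orthogonal_group d" using A by (intro orthogonalI)
  next
    assume "A \<in> complex_orthogonal_group d"
    then have "A\<^sup>T * A = 1\<^sub>m d" by (simp add: complex_orthogonal_group_def)
    then have "?M\<^sup>T * ?M = 1\<^sub>m (Suc d)"
      unfolding m using four_block_one_mat[of d 1] by simp
    then show "?M \<in> complex_orthogonal_group (Suc d)" using c by (intro orthogonalI)
  qed
qed

lemma mult_pole_index:
  assumes "M \<in> carrier_mat (Suc d) (Suc d)" "i < Suc d"
  shows "(M *\<^sub>v pole d) $ i = M $$ (i, d)"
  using assms by (simp add: scalar_prod_def sum.atLeast0_lessThan_Suc pole_index)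

text \<open>A matrix \<open>M\<close> fixing the pole has the pole as its last column. As \<open>M\<close> is orthogonal, its
  transpose fixes the pole too, so the last row is also that of the identity, and \<open>M\<close> splits into
  blocks. This is why spherical congruences of realisations with apex at the pole are the same as
  orthogonal maps of \<open>\<complex>\<^sup>d\<close>.\<close>

lemma stabiliser_of_pole:
  assumes M: "M \<in> complex_orthogonal_group (Suc d)" and fix_pole: "M *\<^sub>v pole d = pole d"
  obtains A where "A \<in> complex_orthogonal_group d" "M = extend_orthogonal d A"
proof -
  have c: "M \<in> carrier_mat (Suc d) (Suc d)" using M by (rule orthogonal_carrier)
  have fixT: "M\<^sup>T *\<^sub>v pole d = pole d"
    using orthogonal_transpose_cancel(1)[OF M, of "pole d"] fix_pole pole_carrier by simp
  have col: "M $$ (i, d) = (if i < d then 0 else 1)" if "i < Suc d" for i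
    using mult_pole_index[OF c that] fix_pole that by (simp add: pole_index)
  have row: "M $$ (d, i) = (if i < d then 0 else 1)" if "i < Suc d" for i
    using mult_pole_index[of "M\<^sup>T" d i] fixT that c by (simp add: pole_index)
  define A where "A = mat d d (\<lambda>(i, j). M $$ (i, j))"
  have A: "A \<in> carrier_mat d d" by (simp add: A_def)
  have "M = extend_orthogonal d A"
    using c col row by (intro eq_matI) (auto simp: A_def extend_orthogonal_def less_Suc_eq)
  with that[of A] M show thesis by (simp add: extend_orthogonal_mem_iff[OF A])
qed

text \<open>On the sphere the height of a point is determined by its distance to the pole. So in a
  cone whose apex is at the pole, the lengths of the spokes determine all heights.\<close>

lemma sqn_diff_pole:
  assumes "z \<in> complex_sphere d"
  shows "sqn (z - pole d) = 2 * (1 - z $ d)"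
proof -
  have zc: "z \<in> carrier_vec (Suc d)" using assms by (simp add: complex_sphere_def)
  define x t where "x = vec_first z d" and "t = z $ d"
  have x: "x \<in> carrier_vec d" and z_eq: "z = snoc x t"
    using snoc_vec_first[OF zc] by (auto simp: x_def t_def)
  have "sqn x + t\<^sup>2 = 1"
    using assms x unfolding z_eq by (simp add: complex_sphere_def sqn_snoc)
  moreover have "z - pole d = snoc x (t - 1)"
    using x unfolding z_eq by (subst snoc_diff[of _ d]) auto
  ultimately show ?thesis
    using x by (simp add: sqn_snoc[OF x] t_def[symmetric] power2_diff algebra_simps)
qed

text \<open>The mirror of the reflection that interchanges \<open>u\<close> and the pole is orthogonal to their
  difference. By the formula above that difference is isotropic exactly when \<open>u $ d = 1\<close>, which over
  \<open>\<complex>\<close> does not force \<open>u\<close> to be the pole. The entries of the reflection are rational functions of \<open>u\<close>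
  with denominator \<open>1 - u $ d\<close>.\<close>

lemma householder_to_pole:
  assumes u: "u \<in> complex_sphere d" and nz: "u $ d \<noteq> 1"
  shows "householder (u - pole d) \<in> complex_orthogonal_group (Suc d)"
    and "householder (u - pole d) *\<^sub>v u = pole d"
proof -
  have uc: "u \<in> carrier_vec (Suc d)" and u1: "u \<bullet> u = 1"
    using u by (auto simp: complex_sphere_def sqn_def)
  define x t where "x = vec_first u d" and "t = u $ d"
  have x: "x \<in> carrier_vec d" and u_eq: "u = snoc x t"
    using snoc_vec_first[OF uc] by (auto simp: x_def t_def)
  have xt: "x \<bullet> x + t\<^sup>2 = 1"
    using u1 x unfolding u_eq by (simp add: scalar_prod_snoc power2_eq_square)
  have w_eq: "u - pole d = snoc x (t - 1)"
    using x unfolding u_eq by (subst snoc_diff[of _ d]) auto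
  have wc: "u - pole d \<in> carrier_vec (Suc d)"
    unfolding w_eq using x by (rule snoc_carrier)
  note sq = sqn_diff_pole[OF u]
  have nz': "sqn (u - pole d) \<noteq> 0"
    unfolding sq using nz by simp
  show o: "householder (u - pole d) \<in> complex_orthogonal_group (Suc d)"
    using wc nz' by (rule householder_orthogonal)
  have sp: "(u - pole d) \<bullet> u = 1 - u $ d"
    unfolding w_eq using xt x
    by (simp add: u_eq scalar_prod_snoc power2_eq_square snoc_index algebra_simps)
  have "2 / sqn (u - pole d) * ((u - pole d) \<bullet> u) = 1"
    unfolding sp sq using nz by (simp add: field_simps)
  then have "(householder (u - pole d) *\<^sub>v u) $ i = pole d $ i" if "i < Suc d" for i
    using householder_apply[OF wc uc that] that uc by (simp add: pole_index)
  then show "householder (u - pole d) *\<^sub>v u = pole d"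
    using orthogonal_carrier[OF o] by (intro eq_vecI) auto
qed

text \<open>If \<open>u\<close> minus the pole is isotropic, then \<open>- u\<close> minus the pole is not; reflect \<open>- u\<close> to the
  pole and change the sign of the reflection.\<close>

lemma orthogonal_transitive_on_sphere:
  assumes u: "u \<in> complex_sphere d"
  obtains M where "M \<in> complex_orthogonal_group (Suc d)" "M *\<^sub>v u = pole d"
proof (cases "u $ d = 1")
  case False
  then show thesis using householder_to_pole[OF u] that by blast
next
  case True
  have uc: "u \<in> carrier_vec (Suc d)" using u by (simp add: complex_sphere_def)
  have neg: "- u \<in> complex_sphere d" and nz: "(- u) $ d \<noteq> 1"
    using u uc True by (auto simp: complex_sphere_def sqn_def)
  let ?H = "householder (- u - pole d)"
  have o: "?H \<in> complex_orthogonal_group (Suc d)" and H: "?H *\<^sub>v (- u) = pole d"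
    using householder_to_pole[OF neg nz] by auto
  have Hc: "?H \<in> carrier_mat (Suc d) (Suc d)" using o by (rule orthogonal_carrier)
  have "- ?H \<in> complex_orthogonal_group (Suc d)"
    using o Hc by (auto simp: complex_orthogonal_group_def transpose_uminus)
  moreover have "(- ?H) *\<^sub>v u = pole d"
  proof -
    have "?H *\<^sub>v (- u) = - ?H *\<^sub>v u"
      using Hc uc by (intro eq_vecI) auto
    then show ?thesis using H by simp
  qed
  ultimately show thesis using that by blast
qed

section \<open>Congruence and measurements\<close>

lemma realisations_carrier: "p \<in> realisations d V \<Longrightarrow> v \<in> V \<Longrightarrow> p v \<in> carrier_vec d"
  by (auto simp: realisations_def)

lemma spherical_realisations_carrier:
  "p \<in> spherical_realisations d V \<Longrightarrow> v \<in> V \<Longrightarrow> p v \<in> carrier_vec (Suc d)"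
  by (auto simp: spherical_realisations_def complex_sphere_def)

lemma equiv_congruence: "equiv (realisations d V) (congruence d V)"
proof (rule equivI)
  show "congruence d V \<subseteq> realisations d V \<times> realisations d V"
    by (auto simp: congruence_def)
  show "refl_on (realisations d V) (congruence d V)"
  proof (rule refl_onI)
    fix p assume p: "p \<in> realisations d V"
    then have "\<forall>v\<in>V. p v = 1\<^sub>m d *\<^sub>v p v + 0\<^sub>v d"
      using realisations_carrier[OF p] by simp
    then show "(p, p) \<in> congruence d V"
      using p orthogonal_one zero_carrier_vec unfolding congruence_def by blast
  qed
  show "sym (congruence d V)"
  proof (rule symI)
    fix p q assume "(p, q) \<in> congruence d V"
    then obtain A x where p: "p \<in> realisations d V" and q: "q \<in> realisations d V"
      and A: "A \<in> complex_orthogonal_group d" and x: "x \<in> carrier_vec d"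
      and eq: "\<forall>v\<in>V. p v = A *\<^sub>v q v + x"
      by (auto simp: congruence_def)
    have AT: "A\<^sup>T \<in> complex_orthogonal_group d" using A by (rule orthogonal_transpose)
    have Ac: "A \<in> carrier_mat d d" using A by (rule orthogonal_carrier)
    then have ATc: "A\<^sup>T \<in> carrier_mat d d" by simp
    have tx: "- (A\<^sup>T *\<^sub>v x) \<in> carrier_vec d" using ATc x by simp
    have "q v = A\<^sup>T *\<^sub>v p v + - (A\<^sup>T *\<^sub>v x)" if "v \<in> V" for v
    proof -
      have qv: "q v \<in> carrier_vec d" using q that by (rule realisations_carrier)
      have "A\<^sup>T *\<^sub>v p v = A\<^sup>T *\<^sub>v (A *\<^sub>v q v) + A\<^sup>T *\<^sub>v x"
        using eq that qv x Ac ATc by (simp add: mult_add_distrib_mat_vec[of _ d d])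
      then have "A\<^sup>T *\<^sub>v p v = q v + A\<^sup>T *\<^sub>v x"
        using orthogonal_transpose_cancel(1)[OF A qv] by simp
      then show ?thesis
        using qv tx ATc x by (intro eq_vecI) auto
    qed
    then show "(q, p) \<in> congruence d V"
      using p q AT tx unfolding congruence_def by blast
  qed
  show "trans (congruence d V)"
  proof (rule transI)
    fix p q r assume pq: "(p, q) \<in> congruence d V" and qr: "(q, r) \<in> congruence d V"
    obtain A x where p: "p \<in> realisations d V"
      and A: "A \<in> complex_orthogonal_group d" and x: "x \<in> carrier_vec d"
      and eq: "\<forall>v\<in>V. p v = A *\<^sub>v q v + x"
      using pq by (auto simp: congruence_def)
    obtain B y where r: "r \<in> realisations d V"
      and B: "B \<in> complex_orthogonal_group d" and y: "y \<in> carrier_vec d"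
      and eq': "\<forall>v\<in>V. q v = B *\<^sub>v r v + y"
      using qr by (auto simp: congruence_def)
    have Ac: "A \<in> carrier_mat d d" and Bc: "B \<in> carrier_mat d d"
      using A B by (auto dest: orthogonal_carrier)
    have c: "A *\<^sub>v y + x \<in> carrier_vec d" using Ac x y by simp
    have "p v = (A * B) *\<^sub>v r v + (A *\<^sub>v y + x)" if "v \<in> V" for v
    proof -
      have rv: "r v \<in> carrier_vec d" using r that by (rule realisations_carrier)
      have "p v = A *\<^sub>v (B *\<^sub>v r v) + A *\<^sub>v y + x"
        using eq eq' that rv y Ac Bc by (simp add: mult_add_distrib_mat_vec[of _ d d])
      then show ?thesis
        using rv x y Ac Bc by (simp add: assoc_add_vec[of _ d] assoc_mult_mat_vec[of A d d B d])
    qed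
    then show "(p, r) \<in> congruence d V"
      using p r orthogonal_mult[OF A B] c unfolding congruence_def by blast
  qed
qed

lemma equiv_spherical_congruence:
  "equiv (spherical_realisations d V) (spherical_congruence d V)"
proof (rule equivI)
  show "spherical_congruence d V \<subseteq> spherical_realisations d V \<times> spherical_realisations d V"
    by (auto simp: spherical_congruence_def)
  show "refl_on (spherical_realisations d V) (spherical_congruence d V)"
  proof (rule refl_onI)
    fix p assume p: "p \<in> spherical_realisations d V"
    then have "\<forall>v\<in>V. p v = 1\<^sub>m (d + 1) *\<^sub>v p v"
      using spherical_realisations_carrier[OF p] by simp
    then show "(p, p) \<in> spherical_congruence d V"
      using p orthogonal_one unfolding spherical_congruence_def by blast
  qed
  show "sym (spherical_congruence d V)"
  proof (rule symI)
    fix p q assume "(p, q) \<in> spherical_congruence d V"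
    then obtain A where p: "p \<in> spherical_realisations d V" and q: "q \<in> spherical_realisations d V"
      and A: "A \<in> complex_orthogonal_group (d + 1)" and eq: "\<forall>v\<in>V. p v = A *\<^sub>v q v"
      by (auto simp: spherical_congruence_def)
    have "\<forall>v\<in>V. q v = A\<^sup>T *\<^sub>v p v"
      using eq orthogonal_transpose_cancel(1)[OF A] spherical_realisations_carrier[OF q] by simp
    then show "(q, p) \<in> spherical_congruence d V"
      using p q orthogonal_transpose[OF A] unfolding spherical_congruence_def by blast
  qed
  show "trans (spherical_congruence d V)"
  proof (rule transI)
    fix p q r assume pq: "(p, q) \<in> spherical_congruence d V"
      and qr: "(q, r) \<in> spherical_congruence d V"
    obtain A where p: "p \<in> spherical_realisations d V"
      and A: "A \<in> complex_orthogonal_group (d + 1)" and eq: "\<forall>v\<in>V. p v = A *\<^sub>v q v"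
      using pq by (auto simp: spherical_congruence_def)
    obtain B where r: "r \<in> spherical_realisations d V"
      and B: "B \<in> complex_orthogonal_group (d + 1)" and eq': "\<forall>v\<in>V. q v = B *\<^sub>v r v"
      using qr by (auto simp: spherical_congruence_def)
    have "\<forall>v\<in>V. p v = (A * B) *\<^sub>v r v"
      using eq eq' spherical_realisations_carrier[OF r] orthogonal_carrier[OF A]
        orthogonal_carrier[OF B]
      by (simp add: assoc_mult_mat_vec[of A "Suc d" "Suc d" B "Suc d"])
    then show "(p, r) \<in> spherical_congruence d V"
      using p r orthogonal_mult[OF A B] unfolding spherical_congruence_def by blast
  qed
qed

lemma measurement_map_eq_iff:
  assumes G: "finite_simple_graph V E"
    and p: "\<And>v. v \<in> V \<Longrightarrow> p v \<in> carrier_vec m" and q: "\<And>v. v \<in> V \<Longrightarrow> q v \<in> carrier_vec n"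
  shows "measurement_map E p = measurement_map E q \<longleftrightarrow>
    (\<forall>v w. {v, w} \<in> E \<longrightarrow> sqn (p v - p w) = sqn (q v - q w))"
proof
  have inV: "v \<in> V \<and> w \<in> V" if "{v, w} \<in> E" for v w
    using G that by (auto simp: finite_simple_graph_def)
  { assume eq: "measurement_map E p = measurement_map E q"
    show "\<forall>v w. {v, w} \<in> E \<longrightarrow> sqn (p v - p w) = sqn (q v - q w)"
    proof (intro allI impI)
      fix v w assume e: "{v, w} \<in> E"
      then have "edge_measurement p {v, w} = edge_measurement q {v, w}"
        using fun_cong[OF eq, of "{v, w}"] by (simp add: measurement_map_def)
      then show "sqn (p v - p w) = sqn (q v - q w)"
        using inV[OF e] edge_measurement_pair[of p v m w] edge_measurement_pair[of q v n w] p q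
        by simp
    qed }
  { assume eq: "\<forall>v w. {v, w} \<in> E \<longrightarrow> sqn (p v - p w) = sqn (q v - q w)"
    show "measurement_map E p = measurement_map E q"
      unfolding measurement_map_def
    proof (rule restrict_ext)
      fix e assume e: "e \<in> E"
      then have "card e = 2" using G by (auto simp: finite_simple_graph_def)
      then obtain v w where vw: "e = {v, w}" by (auto simp: card_2_iff)
      then show "edge_measurement p e = edge_measurement q e"
        using e eq inV[of v w] p q
        by (simp add: edge_measurement_pair[of p v m w] edge_measurement_pair[of q v n w])
    qed }
qed

section \<open>Suspension of Euclidean realisations\<close>

text \<open>Translate the apex to the origin and lift each vertex \<open>v\<close> to height \<open>t v\<close>. The heights for
  which the result lies on the sphere are square roots; both roots are admitted at every vertex,
  the apex included, where they are \<open>1\<close> and \<open>- 1\<close>.\<close>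

definition suspension ::
    "'v set \<Rightarrow> 'v \<Rightarrow> ('v \<Rightarrow> complex vec) \<Rightarrow> ('v \<Rightarrow> complex) \<Rightarrow> 'v \<Rightarrow> complex vec" where
  "suspension V a x t = (\<lambda>v\<in>V. snoc (x v - x a) (t v))"

definition is_height :: "'v set \<Rightarrow> 'v \<Rightarrow> ('v \<Rightarrow> complex vec) \<Rightarrow> ('v \<Rightarrow> complex) \<Rightarrow> bool" where
  "is_height V a x t \<longleftrightarrow> (\<forall>v\<in>V. (t v)\<^sup>2 = 1 - sqn (x v - x a))"

text \<open>A cone as seen from the coned graph, the base being what remains when \<open>a\<close> is deleted.\<close>

locale cone =
  fixes V :: "'v set" and E :: "'v set set" and a :: 'v
  assumes graph: "finite_simple_graph V E"
    and apex: "a \<in> V"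
    and spokes: "\<And>v. v \<in> V \<Longrightarrow> v \<noteq> a \<Longrightarrow> {a, v} \<in> E"
begin

lemma suspension_spherical:
  assumes x: "x \<in> realisations d V" and t: "is_height V a x t"
  shows "suspension V a x t \<in> spherical_realisations d V"
proof -
  have "snoc (x v - x a) (t v) \<in> complex_sphere d" if "v \<in> V" for v
  proof -
    have c: "x v - x a \<in> carrier_vec d"
      using realisations_carrier[OF x] that apex by simp
    show ?thesis
      using t that snoc_carrier[OF c] by (simp add: complex_sphere_def sqn_snoc[OF c] is_height_def)
  qed
  then show ?thesis
    by (simp add: suspension_def spherical_realisations_def)
qed

text \<open>With the heights held fixed, suspension changes all squared edge lengths by constants, so it maps
  fibres of the Euclidean measurement map to fibres of the spherical one.\<close>

lemma sqn_diff_suspension: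
  assumes x: "x \<in> realisations d V" and v: "v \<in> V" and w: "w \<in> V"
  shows "sqn (suspension V a x t v - suspension V a x t w) = sqn (x v - x w) + (t v - t w)\<^sup>2"
proof -
  have c: "x v \<in> carrier_vec d" "x w \<in> carrier_vec d" "x a \<in> carrier_vec d"
    using realisations_carrier[OF x] v w apex by auto
  have "x v - x a - (x w - x a) = x v - x w"
    using c by (intro eq_vecI) auto
  then show ?thesis
    using v w c by (simp add: suspension_def snoc_diff[of _ d] sqn_snoc[of _ d])
qed

text \<open>Conversely, dropping the last coordinate inverts suspension. The condition on \<open>x\<close> leaves its
  position up to translation free.\<close>

lemma suspension_of_projection:
  assumes q: "q \<in> spherical_realisations d V" and qa: "q a = pole d"
    and x: "\<And>v. v \<in> V \<Longrightarrow> x v - x a = vec_first (q v) d"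
  shows "suspension V a x (\<lambda>v. q v $ d) = q" and "is_height V a x (\<lambda>v. q v $ d)"
    and "q a $ d = 1"
proof -
  have snoc: "snoc (x v - x a) (q v $ d) = q v" if "v \<in> V" for v
    using x[OF that] snoc_vec_first[OF spherical_realisations_carrier[OF q that]] by simp
  show "suspension V a x (\<lambda>v. q v $ d) = q"
  proof
    fix v
    show "suspension V a x (\<lambda>v. q v $ d) v = q v"
      using q snoc by (cases "v \<in> V") (auto simp: suspension_def spherical_realisations_def)
  qed
  have "(q v $ d)\<^sup>2 = 1 - sqn (x v - x a)" if v: "v \<in> V" for v
  proof -
    have "sqn (q v) = 1"
      using q v by (auto simp: spherical_realisations_def complex_sphere_def)
    moreover have "sqn (q v) = sqn (x v - x a) + (q v $ d)\<^sup>2"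
      using sqn_snoc[of "x v - x a" d "q v $ d"] snoc[OF v] x[OF v] by simp
    ultimately show ?thesis by (simp add: algebra_simps)
  qed
  then show "is_height V a x (\<lambda>v. q v $ d)" by (simp add: is_height_def)
  show "q a $ d = 1" by (simp add: qa pole_index)
qed

text \<open>The correspondence of realisations. All members of the Euclidean fibre of \<open>x\<close> are suspended
  with the same heights \<open>t\<close>, which is possible because they have the same spoke lengths. Two
  suspensions are congruent by a matrix that fixes the pole, hence by one coming from \<open>\<complex>\<^sup>d\<close>. Every
  member of the spherical fibre can be rotated so that its apex is at the pole, and then its heights
  are \<open>t\<close>, again by the spoke lengths.\<close>

lemma ecard_realisation_classes_suspension:
  assumes x: "x \<in> realisations d V" and t: "is_height V a x t" and ta: "t a = 1"
  shows "ecard (realisation_classes d V E x) =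
    ecard (spherical_realisation_classes d V E (suspension V a x t))"
proof -
  define S where "S y = suspension V a y t" for y
  define FE where "FE = {y \<in> realisations d V. measurement_map E y = measurement_map E x}"
  define FS where
    "FS = {q \<in> spherical_realisations d V. measurement_map E q = measurement_map E (S x)}"
  have FE_iff: "y \<in> FE \<longleftrightarrow> (\<forall>v w. {v, w} \<in> E \<longrightarrow> sqn (y v - y w) = sqn (x v - x w))"
    if "y \<in> realisations d V" for y
    using measurement_map_eq_iff[OF graph, of y d x d] that realisations_carrier[of _ d V] x
    by (simp add: FE_def)
  have Sx: "S x \<in> spherical_realisations d V"
    unfolding S_def using x t by (rule suspension_spherical)
  have FS_iff: "q \<in> FS \<longleftrightarrow> (\<forall>v w. {v, w} \<in> E \<longrightarrow> sqn (q v - q w) = sqn (S x v - S x w))"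
    if "q \<in> spherical_realisations d V" for q
    using measurement_map_eq_iff[OF graph, of q "Suc d" "S x" "Suc d"] that Sx
      spherical_realisations_carrier[of _ d V] by (simp add: FS_def)
  have ends: "v \<in> V \<and> w \<in> V" if "{v, w} \<in> E" for v w
    using graph that by (auto simp: finite_simple_graph_def)
  have S_pole: "S y a = pole d" if "y \<in> realisations d V" for y
  proof -
    have "y a - y a = 0\<^sub>v d"
      using realisations_carrier[OF that apex] by simp
    then show ?thesis using apex ta by (simp add: S_def suspension_def)
  qed
  have S_fibre: "S y \<in> FS" if y: "y \<in> FE" for y
  proof -
    have yr: "y \<in> realisations d V" using y by (simp add: FE_def)
    have same: "\<forall>v w. {v, w} \<in> E \<longrightarrow> sqn (y v - y w) = sqn (x v - x w)"
      using y FE_iff[OF yr] by simp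
    have "(t v)\<^sup>2 = 1 - sqn (y v - y a)" if "v \<in> V" for v
    proof (cases "v = a")
      case True
      have "y a \<in> carrier_vec d" using yr apex by (rule realisations_carrier)
      then show ?thesis using ta True by (simp add: sqn_def)
    next
      case False
      then have "sqn (y v - y a) = sqn (x v - x a)"
        using same spokes[OF that] by (simp add: insert_commute)
      then show ?thesis using t that by (simp add: is_height_def)
    qed
    then have "S y \<in> spherical_realisations d V"
      unfolding S_def using yr by (intro suspension_spherical) (simp_all add: is_height_def)
    then show ?thesis
      using same ends unfolding FS_iff[OF \<open>S y \<in> _\<close>]
      by (auto simp: S_def sqn_diff_suspension[OF yr] sqn_diff_suspension[OF x])
  qed
  have S_congruent: "(y, y') \<in> congruence d V \<longleftrightarrow> (S y, S y') \<in> spherical_congruence d V"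
    if y: "y \<in> FE" and y': "y' \<in> FE" for y y'
  proof -
    have yr: "y \<in> realisations d V" "y' \<in> realisations d V"
      using y y' by (simp_all add: FE_def)
    have Sr: "S y \<in> spherical_realisations d V" "S y' \<in> spherical_realisations d V"
      using S_fibre y y' by (simp_all add: FS_def)
    have c: "y v \<in> carrier_vec d" "y' v \<in> carrier_vec d" if "v \<in> V" for v
      using yr that by (auto intro: realisations_carrier)
    note ca = c[OF apex]
    show ?thesis
    proof
      assume "(y, y') \<in> congruence d V"
      then obtain A b where A: "A \<in> complex_orthogonal_group d" and b: "b \<in> carrier_vec d"
        and eq: "\<forall>v\<in>V. y v = A *\<^sub>v y' v + b"
        by (auto simp: congruence_def)
      have Ac: "A \<in> carrier_mat d d" using A by (rule orthogonal_carrier)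
      have "S y v = extend_orthogonal d A *\<^sub>v S y' v" if "v \<in> V" for v
      proof -
        have "A *\<^sub>v (y' v - y' a) = A *\<^sub>v y' v - A *\<^sub>v y' a"
          using c[OF that] ca Ac by (simp add: mult_minus_distrib_mat_vec[of _ d d])
        moreover have "\<dots> = (A *\<^sub>v y' v + b) - (A *\<^sub>v y' a + b)"
          using c[OF that] ca Ac b by (intro eq_vecI) auto
        ultimately have "y v - y a = A *\<^sub>v (y' v - y' a)"
          using eq that apex by simp
        then show ?thesis
          using that c[OF that] ca Ac by (simp add: S_def suspension_def extend_orthogonal_snoc)
      qed
      then show "(S y, S y') \<in> spherical_congruence d V"
        using Sr A extend_orthogonal_mem_iff[OF Ac] by (auto simp: spherical_congruence_def)
    next
      assume "(S y, S y') \<in> spherical_congruence d V"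
      then obtain M where M: "M \<in> complex_orthogonal_group (Suc d)"
        and eq: "\<forall>v\<in>V. S y v = M *\<^sub>v S y' v"
        by (auto simp: spherical_congruence_def)
      have "M *\<^sub>v pole d = pole d"
        using eq apex S_pole yr by metis
      with M obtain A where A: "A \<in> complex_orthogonal_group d" and MA: "M = extend_orthogonal d A"
        by (rule stabiliser_of_pole)
      have Ac: "A \<in> carrier_mat d d" using A by (rule orthogonal_carrier)
      have "y v = A *\<^sub>v y' v + (y a - A *\<^sub>v y' a)" if "v \<in> V" for v
      proof -
        have d: "y v - y a \<in> carrier_vec d" "A *\<^sub>v (y' v - y' a) \<in> carrier_vec d"
          using c[OF that] ca Ac by auto
        have "snoc (y v - y a) (t v) = snoc (A *\<^sub>v (y' v - y' a)) (t v)"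
          using eq that c[OF that] ca Ac
          by (simp add: MA S_def suspension_def extend_orthogonal_snoc)
        then have "y v - y a = A *\<^sub>v (y' v - y' a)"
          using snoc_eq_iff[OF d] by simp
        also have "\<dots> = A *\<^sub>v y' v - A *\<^sub>v y' a"
          using c[OF that] ca Ac by (simp add: mult_minus_distrib_mat_vec[of _ d d])
        finally have *: "y v - y a = A *\<^sub>v y' v - A *\<^sub>v y' a" .
        show ?thesis
        proof (rule eq_vecI)
          fix i assume "i < dim_vec (A *\<^sub>v y' v + (y a - A *\<^sub>v y' a))"
          then have i: "i < d" using Ac by simp
          have "y v $ i - y a $ i = (A *\<^sub>v y' v) $ i - (A *\<^sub>v y' a) $ i"
            using arg_cong[OF *, of "\<lambda>z. z $ i"] i c[OF that] ca Ac by simp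
          then show "y v $ i = (A *\<^sub>v y' v + (y a - A *\<^sub>v y' a)) $ i"
            using i c[OF that] ca Ac by (simp add: algebra_simps)
        qed (use c[OF that] ca Ac in auto)
      qed
      moreover have "y a - A *\<^sub>v y' a \<in> carrier_vec d" using ca Ac by auto
      ultimately show "(y, y') \<in> congruence d V"
        using yr A unfolding congruence_def by blast
    qed
  qed
  have S_surj: "\<exists>y\<in>FE. (S y, q) \<in> spherical_congruence d V" if q: "q \<in> FS" for q
  proof -
    have qr: "q \<in> spherical_realisations d V" using q by (simp add: FS_def)
    have same: "\<forall>v w. {v, w} \<in> E \<longrightarrow> sqn (q v - q w) = sqn (S x v - S x w)"
      using q FS_iff[OF qr] by simp
    have "q a \<in> complex_sphere d" using qr apex by (auto simp: spherical_realisations_def)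
    then obtain M where M: "M \<in> complex_orthogonal_group (Suc d)" and Ma: "M *\<^sub>v q a = pole d"
      by (rule orthogonal_transitive_on_sphere)
    have Mc: "M \<in> carrier_mat (Suc d) (Suc d)" using M by (rule orthogonal_carrier)
    have qc: "q v \<in> carrier_vec (Suc d)" if "v \<in> V" for v
      using qr that by (rule spherical_realisations_carrier)
    have Mq: "M *\<^sub>v q v \<in> complex_sphere d" if "v \<in> V" for v
      using qr that Mc qc[OF that] sqn_orthogonal[OF M qc[OF that]]
      by (auto simp: spherical_realisations_def complex_sphere_def)
    have Mdiff: "sqn (M *\<^sub>v q v - M *\<^sub>v q w) = sqn (q v - q w)" if "v \<in> V" "w \<in> V" for v w
      using sqn_orthogonal[OF M, of "q v - q w"] qc[OF that(1)] qc[OF that(2)] Mc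
      by (simp add: mult_minus_distrib_mat_vec[of _ "Suc d" "Suc d"])
    have Sxs: "S x v \<in> complex_sphere d" if "v \<in> V" for v
      using Sx that by (auto simp: spherical_realisations_def)
    have height: "(M *\<^sub>v q v) $ d = t v" if v: "v \<in> V" for v
    proof -
      have xc: "x v - x a \<in> carrier_vec d"
        using realisations_carrier[OF x] v apex by auto
      have "(M *\<^sub>v q v) $ d = S x v $ d"
      proof (cases "v = a")
        case True
        then show ?thesis using Ma S_pole[OF x] by simp
      next
        case False
        then have "{v, a} \<in> E" using spokes[OF v] by (simp add: insert_commute)
        then have "sqn (M *\<^sub>v q v - pole d) = sqn (S x v - pole d)"
          using same Mdiff[OF v apex] Ma S_pole[OF x] by simp
        then show ?thesis
          using sqn_diff_pole[OF Mq[OF v]] sqn_diff_pole[OF Sxs[OF v]] by simp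
      qed
      then show ?thesis
        using v snoc_index[OF xc] by (simp add: S_def suspension_def)
    qed
    define y where "y = (\<lambda>v\<in>V. vec_first (M *\<^sub>v q v) d)"
    have yr: "y \<in> realisations d V" by (simp add: y_def realisations_def)
    have ya: "y a = 0\<^sub>v d"
      using Ma apex by (intro eq_vecI) (auto simp: y_def vec_first_def pole_index)
    have Sy: "S y v = M *\<^sub>v q v" if "v \<in> V" for v
    proof -
      have "M *\<^sub>v q v \<in> carrier_vec (Suc d)"
        using Mc qc[OF that] by simp
      then have "snoc (y v) (t v) = M *\<^sub>v q v"
        using snoc_vec_first[of "M *\<^sub>v q v" d] height[OF that] that by (simp add: y_def)
      moreover have "y v - y a = y v"
        using realisations_carrier[OF yr that] by (simp add: ya)
      ultimately show ?thesis using that by (simp add: S_def suspension_def)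
    qed
    have "sqn (y v - y w) = sqn (x v - x w)" if e: "{v, w} \<in> E" for v w
    proof -
      have vw: "v \<in> V" "w \<in> V" using ends[OF e] by auto
      have "sqn (S y v - S y w) = sqn (S x v - S x w)"
        using same e Mdiff[OF vw] Sy vw by simp
      then show ?thesis
        using vw by (simp add: S_def sqn_diff_suspension[OF yr] sqn_diff_suspension[OF x])
    qed
    then have "y \<in> FE" using FE_iff[OF yr] by simp
    moreover have "(S y, q) \<in> spherical_congruence d V"
      using S_fibre[OF \<open>y \<in> FE\<close>] qr M Sy by (auto simp: FS_def spherical_congruence_def)
    ultimately show ?thesis by blast
  qed
  have "ecard (FE // congruence d V) = ecard (FS // spherical_congruence d V)"
    by (rule ecard_quotient_transfer[OF equiv_congruence equiv_spherical_congruence, where \<phi> = S])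
      (use S_fibre S_congruent S_surj in \<open>auto simp: FE_def FS_def\<close>)
  then show ?thesis
    by (simp add: FE_def FS_def S_def realisation_classes_def spherical_realisation_classes_def)
qed

lemma spherical_realisation_classes_orthogonal:
  assumes M: "M \<in> complex_orthogonal_group (Suc d)" and q: "q \<in> spherical_realisations d V"
  shows "spherical_realisation_classes d V E (\<lambda>v\<in>V. M *\<^sub>v q v) =
    spherical_realisation_classes d V E q"
proof -
  have Mc: "M \<in> carrier_mat (Suc d) (Suc d)" using M by (rule orthogonal_carrier)
  have qc: "q v \<in> carrier_vec (Suc d)" if "v \<in> V" for v
    using q that by (rule spherical_realisations_carrier)
  have "sqn (M *\<^sub>v q v - M *\<^sub>v q w) = sqn (q v - q w)" if "{v, w} \<in> E" for v w
  proof -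
    have vw: "v \<in> V" "w \<in> V" using graph that by (auto simp: finite_simple_graph_def)
    show ?thesis
      using sqn_orthogonal[OF M, of "q v - q w"] qc[OF vw(1)] qc[OF vw(2)] Mc
      by (simp add: mult_minus_distrib_mat_vec[of _ "Suc d" "Suc d"])
  qed
  moreover have "v \<in> V \<and> w \<in> V" if "{v, w} \<in> E" for v w
    using graph that by (auto simp: finite_simple_graph_def)
  ultimately have "measurement_map E (\<lambda>v\<in>V. M *\<^sub>v q v) = measurement_map E q"
    using Mc qc by (subst measurement_map_eq_iff[OF graph, of _ "Suc d" _ "Suc d"]) auto
  then show ?thesis by (simp add: spherical_realisation_classes_def)
qed

lemma orthogonal_image_spherical:
  assumes M: "M \<in> complex_orthogonal_group (Suc d)" and q: "q \<in> spherical_realisations d V"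
  shows "(\<lambda>v\<in>V. M *\<^sub>v q v) \<in> spherical_realisations d V"
  using q orthogonal_carrier[OF M] sqn_orthogonal[OF M]
  by (auto simp: spherical_realisations_def complex_sphere_def PiE_iff)

end

section \<open>Algebras of polynomial functions\<close>

text \<open>Lets one substitution lemma, \<open>polynomial_substitution\<close>, serve for polynomial and for rational
  substitutions and for substitutions that involve square roots.\<close>

definition function_algebra :: "('s \<Rightarrow> complex) set \<Rightarrow> bool" where
  "function_algebra Q \<longleftrightarrow> (\<forall>c. (\<lambda>s. c) \<in> Q) \<and>
    (\<forall>f\<in>Q. \<forall>g\<in>Q. (\<lambda>s. f s + g s) \<in> Q \<and> (\<lambda>s. f s * g s) \<in> Q)"

lemma function_algebra_polynomial_functions: "function_algebra (polynomial_functions n V)"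
  by (auto simp: function_algebra_def intro: polynomial_functions.intros)

context
  fixes Q :: "('s \<Rightarrow> complex) set"
  assumes Q: "function_algebra Q"
begin

lemma algebra_const: "(\<lambda>s. c) \<in> Q"
  and algebra_add: "f \<in> Q \<Longrightarrow> g \<in> Q \<Longrightarrow> (\<lambda>s. f s + g s) \<in> Q"
  and algebra_mult: "f \<in> Q \<Longrightarrow> g \<in> Q \<Longrightarrow> (\<lambda>s. f s * g s) \<in> Q"
  using Q by (auto simp: function_algebra_def)

lemma algebra_diff: "f \<in> Q \<Longrightarrow> g \<in> Q \<Longrightarrow> (\<lambda>s. f s - g s) \<in> Q"
  using algebra_add[OF _ algebra_mult[OF algebra_const[of "-1"]], of f g] by simp

lemma algebra_power: "f \<in> Q \<Longrightarrow> (\<lambda>s. f s ^ m) \<in> Q"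
  by (induction m) (auto intro: algebra_const algebra_mult)

lemma algebra_sum:
  "finite J \<Longrightarrow> (\<And>j. j \<in> J \<Longrightarrow> F j \<in> Q) \<Longrightarrow> (\<lambda>s. \<Sum>j\<in>J. F j s) \<in> Q"
  by (induction J rule: finite_induct) (auto intro: algebra_const algebra_add)

lemma polynomial_substitution:
  assumes "f \<in> polynomial_functions n V"
    and coord: "\<And>v i. v \<in> V \<Longrightarrow> i < n \<Longrightarrow> (\<lambda>s. \<sigma> s v $ i) \<in> Q"
  shows "(\<lambda>s. f (\<sigma> s)) \<in> Q"
  using assms(1)
  by induction (auto intro: algebra_const algebra_add algebra_mult coord)

end

lemmas polynomial_const = algebra_const[OF function_algebra_polynomial_functions]
  and polynomial_add = algebra_add[OF function_algebra_polynomial_functions]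
  and polynomial_mult = algebra_mult[OF function_algebra_polynomial_functions]
  and polynomial_diff = algebra_diff[OF function_algebra_polynomial_functions]
  and polynomial_power = algebra_power[OF function_algebra_polynomial_functions]
  and polynomial_sum = algebra_sum[OF function_algebra_polynomial_functions]

text \<open>Every non-empty open set contains the non-vanishing locus of a single polynomial, itself
  non-empty.\<close>

lemma holds_generally_iff:
  "holds_generally n V X P \<longleftrightarrow>
    (\<exists>f\<in>polynomial_functions n V. (\<exists>p\<in>X. f p \<noteq> 0) \<and> (\<forall>p\<in>X. f p \<noteq> 0 \<longrightarrow> P p))"
proof
  assume "holds_generally n V X P"
  then obtain F where F: "F \<subseteq> polynomial_functions n V"
    and ne: "X - {p \<in> X. \<forall>f\<in>F. f p = 0} \<noteq> {}"
    and P: "\<forall>p\<in>X - {p \<in> X. \<forall>f\<in>F. f p = 0}. P p"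
    by (auto simp: holds_generally_def zariski_open_in_def)
  then obtain p f where "p \<in> X" "f \<in> F" "f p \<noteq> 0" by blast
  with F P show "\<exists>f\<in>polynomial_functions n V. (\<exists>p\<in>X. f p \<noteq> 0) \<and> (\<forall>p\<in>X. f p \<noteq> 0 \<longrightarrow> P p)"
    by blast
next
  assume "\<exists>f\<in>polynomial_functions n V. (\<exists>p\<in>X. f p \<noteq> 0) \<and> (\<forall>p\<in>X. f p \<noteq> 0 \<longrightarrow> P p)"
  then obtain f where f: "f \<in> polynomial_functions n V" "\<exists>p\<in>X. f p \<noteq> 0"
    "\<forall>p\<in>X. f p \<noteq> 0 \<longrightarrow> P p"
    by blast
  have "zariski_open_in n V X (X - {p \<in> X. \<forall>g\<in>{f}. g p = 0})"
    using f(1) unfolding zariski_open_in_def by blast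
  then show "holds_generally n V X P"
    unfolding holds_generally_def using f(2,3) by (intro exI[of _ "X - {p \<in> X. \<forall>g\<in>{f}. g p = 0}"]) auto
qed

section \<open>Clearing denominators\<close>

text \<open>The localisation of \<open>Q\<close> at \<open>D\<close>, a fraction \<open>k / D ^ m\<close> being compared with \<open>h\<close> only where \<open>D\<close> does
  not vanish.\<close>

definition fractions :: "('s \<Rightarrow> complex) \<Rightarrow> ('s \<Rightarrow> complex) set \<Rightarrow> ('s \<Rightarrow> complex) set" where
  "fractions D Q = {h. \<exists>m. \<exists>k\<in>Q. \<forall>s. D s \<noteq> 0 \<longrightarrow> k s = D s ^ m * h s}"

lemma fractionsI:
  assumes "k \<in> Q" "\<And>s. D s \<noteq> 0 \<Longrightarrow> k s = D s ^ m * h s"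
  shows "h \<in> fractions D Q"
  using assms unfolding fractions_def by auto

lemma function_algebra_fractions:
  assumes Q: "function_algebra Q" and D: "D \<in> Q"
  shows "function_algebra (fractions D Q)"
  unfolding function_algebra_def
proof (intro conjI allI ballI)
  fix c show "(\<lambda>s. c) \<in> fractions D Q"
    unfolding fractions_def using algebra_const[OF Q, of c]
    by (intro CollectI exI[of _ 0] bexI[of _ "\<lambda>s. c"]) simp_all
next
  fix f g assume "f \<in> fractions D Q" "g \<in> fractions D Q"
  then obtain m k n l where k: "k \<in> Q" "\<forall>s. D s \<noteq> 0 \<longrightarrow> k s = D s ^ m * f s"
    and l: "l \<in> Q" "\<forall>s. D s \<noteq> 0 \<longrightarrow> l s = D s ^ n * g s"
    by (auto simp: fractions_def)
  have "(\<lambda>s. D s ^ n * k s + D s ^ m * l s) \<in> Q"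
    using k l D by (intro algebra_add[OF Q] algebra_mult[OF Q] algebra_power[OF Q])
  then show "(\<lambda>s. f s + g s) \<in> fractions D Q"
    unfolding fractions_def using k l
    by (intro CollectI exI[of _ "m + n"] bexI[of _ "\<lambda>s. D s ^ n * k s + D s ^ m * l s"])
      (simp_all add: power_add algebra_simps)
  have "(\<lambda>s. k s * l s) \<in> Q"
    using k l by (intro algebra_mult[OF Q])
  then show "(\<lambda>s. f s * g s) \<in> fractions D Q"
    unfolding fractions_def using k l
    by (intro CollectI exI[of _ "m + n"] bexI[of _ "\<lambda>s. k s * l s"])
      (simp_all add: power_add algebra_simps)
qed

section \<open>Eliminating square roots\<close>

text \<open>Polynomials over \<open>Q\<close> in further variables indexed by \<open>T\<close>. These are to stand for square
  roots of members of \<open>Q\<close>, but are kept as free variables so that either root can be chosen.\<close>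

inductive_set mixed_polynomials ::
    "('s \<Rightarrow> complex) set \<Rightarrow> 'v set \<Rightarrow> ('s \<times> ('v \<Rightarrow> complex) \<Rightarrow> complex) set"
  for Q :: "('s \<Rightarrow> complex) set" and T :: "'v set" where
  base: "g \<in> Q \<Longrightarrow> (\<lambda>s. g (fst s)) \<in> mixed_polynomials Q T"
| root: "v \<in> T \<Longrightarrow> (\<lambda>s. snd s v) \<in> mixed_polynomials Q T"
| add: "f \<in> mixed_polynomials Q T \<Longrightarrow> g \<in> mixed_polynomials Q T \<Longrightarrow>
    (\<lambda>s. f s + g s) \<in> mixed_polynomials Q T"
| mult: "f \<in> mixed_polynomials Q T \<Longrightarrow> g \<in> mixed_polynomials Q T \<Longrightarrow>
    (\<lambda>s. f s * g s) \<in> mixed_polynomials Q T"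

lemma function_algebra_mixed:
  assumes "function_algebra Q"
  shows "function_algebra (mixed_polynomials Q T)"
  unfolding function_algebra_def
  by (auto intro: mixed_polynomials.add mixed_polynomials.mult
      mixed_polynomials.base[where g = "\<lambda>_. _", OF algebra_const[OF assms]])

lemma mixed_polynomials_cong:
  assumes "h \<in> mixed_polynomials Q T" "\<And>v. v \<in> T \<Longrightarrow> t v = t' v"
  shows "h (x, t) = h (x, t')"
  using assms by induction auto

lemma mixed_polynomials_empty:
  assumes Q: "function_algebra Q" and h: "h \<in> mixed_polynomials Q {}"
  shows "(\<lambda>x. h (x, t)) \<in> Q"
  using h by induction (auto intro: algebra_add[OF Q] algebra_mult[OF Q])

text \<open>Modulo \<open>(t w)\<^sup>2 = c\<close>, products of expressions \<open>A + t w * B\<close> are again of this form.\<close>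

lemma mixed_polynomials_split:
  assumes Q: "function_algebra Q" and c: "c \<in> Q"
    and h: "h \<in> mixed_polynomials Q (insert w T)"
  shows "\<exists>A\<in>mixed_polynomials Q T. \<exists>B\<in>mixed_polynomials Q T.
    \<forall>x t. (t w)\<^sup>2 = c x \<longrightarrow> h (x, t) = A (x, t) + t w * B (x, t)"
proof -
  let ?R = "mixed_polynomials Q T"
  note R = function_algebra_mixed[OF Q, of T]
  have c': "(\<lambda>s. c (fst s)) \<in> ?R" using c by (rule mixed_polynomials.base)
  show ?thesis
    using h
  proof induction
    case (base g)
    then have "(\<lambda>s. g (fst s)) \<in> ?R" by (rule mixed_polynomials.base)
    then show ?case
      using algebra_const[OF R, of 0] by (intro bexI[of _ "\<lambda>s. g (fst s)"] bexI[of _ "\<lambda>s. 0"]) auto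
  next
    case (root v)
    show ?case
    proof (cases "v = w")
      case True
      then show ?thesis
        using algebra_const[OF R] by (intro bexI[of _ "\<lambda>s. 0"] bexI[of _ "\<lambda>s. 1"]) auto
    next
      case False
      then have "(\<lambda>s. snd s v) \<in> ?R" using root by (intro mixed_polynomials.root) simp
      then show ?thesis
        using algebra_const[OF R] by (intro bexI[of _ "\<lambda>s. snd s v"] bexI[of _ "\<lambda>s. 0"]) auto
    qed
  next
    case (add f g)
    then obtain A B A' B' where in_R: "A \<in> ?R" "B \<in> ?R" "A' \<in> ?R" "B' \<in> ?R"
      and eq: "\<forall>x t. (t w)\<^sup>2 = c x \<longrightarrow> f (x, t) = A (x, t) + t w * B (x, t)"
        "\<forall>x t. (t w)\<^sup>2 = c x \<longrightarrow> g (x, t) = A' (x, t) + t w * B' (x, t)"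
      by blast
    show ?case
    proof (rule bexI[of _ "\<lambda>s. A s + A' s"], rule bexI[of _ "\<lambda>s. B s + B' s"], intro allI impI)
      show "(\<lambda>s. A s + A' s) \<in> ?R" "(\<lambda>s. B s + B' s) \<in> ?R"
        using in_R by (auto intro: algebra_add[OF R])
      fix x t assume "(t w)\<^sup>2 = c x"
      then show "f (x, t) + g (x, t) = A (x, t) + A' (x, t) + t w * (B (x, t) + B' (x, t))"
        using eq by (simp add: algebra_simps)
    qed
  next
    case (mult f g)
    then obtain A B A' B' where in_R: "A \<in> ?R" "B \<in> ?R" "A' \<in> ?R" "B' \<in> ?R"
      and eq: "\<forall>x t. (t w)\<^sup>2 = c x \<longrightarrow> f (x, t) = A (x, t) + t w * B (x, t)"
        "\<forall>x t. (t w)\<^sup>2 = c x \<longrightarrow> g (x, t) = A' (x, t) + t w * B' (x, t)"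
      by blast
    show ?case
    proof (rule bexI[of _ "\<lambda>s. A s * A' s + c (fst s) * (B s * B' s)"],
        rule bexI[of _ "\<lambda>s. A s * B' s + B s * A' s"], intro allI impI)
      show "(\<lambda>s. A s * A' s + c (fst s) * (B s * B' s)) \<in> ?R" "(\<lambda>s. A s * B' s + B s * A' s) \<in> ?R"
        using in_R c' by (auto intro!: algebra_add[OF R] algebra_mult[OF R])
      fix x t assume tw: "(t w)\<^sup>2 = c x"
      then have "f (x, t) * g (x, t) = (A (x, t) + t w * B (x, t)) * (A' (x, t) + t w * B' (x, t))"
        using eq by simp
      also have "\<dots> = A (x, t) * A' (x, t) + (t w)\<^sup>2 * (B (x, t) * B' (x, t))
          + t w * (A (x, t) * B' (x, t) + B (x, t) * A' (x, t))"
        by (simp add: algebra_simps power2_eq_square)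
      finally show "f (x, t) * g (x, t) =
          A (x, t) * A' (x, t) + c (fst (x, t)) * (B (x, t) * B' (x, t))
          + t w * (A (x, t) * B' (x, t) + B (x, t) * A' (x, t))"
        by (simp add: tw)
    qed
  qed
qed

text \<open>The set of those \<open>x\<close> over which at least one choice of roots makes \<open>h\<close> non-zero contains a
  Zariski neighbourhood of \<open>x0\<close>. One root \<open>s\<close> is removed at a time: write \<open>h = A + s * B\<close>. The values
  \<open>A + s * B\<close> and \<open>A - s * B\<close> cannot both vanish unless \<open>A\<close> and \<open>s * B\<close> do, so it suffices to keep \<open>A\<close>
  non-zero, or to keep \<open>s\<^sup>2 * B\<close> non-zero, and both expressions are polynomials without \<open>s\<close>.\<close>

lemma eliminate_square_roots:
  assumes Q: "function_algebra Q" and "finite T" and c: "\<And>v. v \<in> T \<Longrightarrow> c v \<in> Q"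
    and h: "h \<in> mixed_polynomials Q T"
    and t0: "\<And>v. v \<in> T \<Longrightarrow> (t0 v)\<^sup>2 = c v x0" and h0: "h (x0, t0) \<noteq> 0"
  shows "\<exists>g\<in>Q. g x0 \<noteq> 0 \<and> (\<forall>x. g x \<noteq> 0 \<longrightarrow> (\<exists>t. (\<forall>v\<in>T. (t v)\<^sup>2 = c v x) \<and> h (x, t) \<noteq> 0))"
  using assms(2-)
proof (induction T arbitrary: h rule: finite_induct)
  case empty
  then show ?case
    using mixed_polynomials_empty[OF Q empty.prems(2), of t0]
    by (intro bexI[of _ "\<lambda>x. h (x, t0)"]) auto
next
  case (insert w T)
  have cw: "c w \<in> Q" using insert.prems by simp
  obtain A B where A: "A \<in> mixed_polynomials Q T" and B: "B \<in> mixed_polynomials Q T"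
    and split: "\<forall>x t. (t w)\<^sup>2 = c w x \<longrightarrow> h (x, t) = A (x, t) + t w * B (x, t)"
    using mixed_polynomials_split[OF Q cw insert.prems(2)] by blast
  have ind: "f (x, t(w := s)) = f (x, t)" if "f \<in> mixed_polynomials Q T" for f x t s
    using that insert.hyps by (intro mixed_polynomials_cong) auto
  \<comment> \<open>The factor \<open>c w\<close> keeps the root at \<open>w\<close> away from zero in the second case.\<close>
  let ?f = "if A (x0, t0) \<noteq> 0 then A else (\<lambda>s. c w (fst s) * B s)"
  have f: "?f \<in> mixed_polynomials Q T"
    using A B cw by (auto intro: mixed_polynomials.intros)
  have "h (x0, t0) = A (x0, t0) + t0 w * B (x0, t0)" and w0: "(t0 w)\<^sup>2 = c w x0"
    using split insert.prems by auto
  then have f0: "?f (x0, t0) \<noteq> 0"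
    using insert.prems(4) w0[symmetric] by auto
  have IH: "\<exists>g\<in>Q. g x0 \<noteq> 0 \<and>
      (\<forall>x. g x \<noteq> 0 \<longrightarrow> (\<exists>t. (\<forall>v\<in>T. (t v)\<^sup>2 = c v x) \<and> ?f (x, t) \<noteq> 0))"
    using insert.prems f f0 by (intro insert.IH) auto
  then obtain g where g: "g \<in> Q" "g x0 \<noteq> 0"
    and lift: "\<And>x. g x \<noteq> 0 \<Longrightarrow> \<exists>t. (\<forall>v\<in>T. (t v)\<^sup>2 = c v x) \<and> ?f (x, t) \<noteq> 0"
    by blast
  have "\<exists>t. (\<forall>v\<in>insert w T. (t v)\<^sup>2 = c v x) \<and> h (x, t) \<noteq> 0" if gx: "g x \<noteq> 0" for x
  proof -
    obtain t where t: "\<forall>v\<in>T. (t v)\<^sup>2 = c v x" and ft: "?f (x, t) \<noteq> 0"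
      using lift[OF gx] by blast
    define s where "s = csqrt (c w x)"
    have s: "s\<^sup>2 = c w x" by (simp add: s_def)
    have h_at: "h (x, t(w := r)) = A (x, t) + r * B (x, t)" if "r\<^sup>2 = c w x" for r
      using split that ind[OF A] ind[OF B] by simp
    have roots: "\<forall>v\<in>insert w T. ((t(w := r)) v)\<^sup>2 = c v x" if "r\<^sup>2 = c w x" for r
      using t that insert.hyps by auto
    have "h (x, t(w := s)) \<noteq> 0 \<or> h (x, t(w := - s)) \<noteq> 0"
    proof (rule ccontr)
      assume "\<not> ?thesis"
      then have "A (x, t) + s * B (x, t) = 0" "A (x, t) - s * B (x, t) = 0"
        using h_at[of s] h_at[of "- s"] s by auto
      then have "A (x, t) = 0" "s * B (x, t) = 0"
        by (auto simp: add_eq_0_iff)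
      then show False using ft s by (auto split: if_splits)
    qed
    moreover have "(- s)\<^sup>2 = c w x" using s by simp
    ultimately show ?thesis using roots s by blast
  qed
  with g show ?case by blast
qed

section \<open>General realisations\<close>

context cone
begin

text \<open>Let the non-vanishing of \<open>f\<close> define the open set of spherical realisations, and let \<open>p0\<close> lie in it. A fixed
  orthogonal map \<open>M\<close> moves the apex of \<open>p0\<close> to the pole. Then \<open>f\<close> evaluated at the realisation obtained from
  \<open>x\<close> by suspending and applying the inverse of \<open>M\<close> is a polynomial in \<open>x\<close> and the heights. The heights are
  square roots of polynomials in \<open>x\<close>, so they can be eliminated.\<close>

lemma generally_euclidean_of_spherical:
  assumes "holds_generally (Suc d) V (spherical_realisations d V)
    (\<lambda>p. ecard (spherical_realisation_classes d V E p) = k)"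
  shows "holds_generally d V (realisations d V) (\<lambda>x. ecard (realisation_classes d V E x) = k)"
proof -
  obtain f p0 where f: "f \<in> polynomial_functions (Suc d) V"
    and p0: "p0 \<in> spherical_realisations d V" and f0: "f p0 \<noteq> 0"
    and count: "\<And>p. p \<in> spherical_realisations d V \<Longrightarrow> f p \<noteq> 0 \<Longrightarrow>
      ecard (spherical_realisation_classes d V E p) = k"
    using assms unfolding holds_generally_iff by blast
  have "p0 a \<in> complex_sphere d" using p0 apex by (auto simp: spherical_realisations_def)
  then obtain M where M: "M \<in> complex_orthogonal_group (Suc d)" and Ma: "M *\<^sub>v p0 a = pole d"
    by (rule orthogonal_transitive_on_sphere)
  have Mc: "M \<in> carrier_mat (Suc d) (Suc d)" using M by (rule orthogonal_carrier)
  have MT: "M\<^sup>T \<in> complex_orthogonal_group (Suc d)" using M by (rule orthogonal_transpose)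
  define q0 where "q0 = (\<lambda>v\<in>V. M *\<^sub>v p0 v)"
  have q0: "q0 \<in> spherical_realisations d V"
    unfolding q0_def using M p0 by (rule orthogonal_image_spherical)
  have q0a: "q0 a = pole d" using Ma apex by (simp add: q0_def)
  define x0 where "x0 = (\<lambda>v\<in>V. vec_first (q0 v) d)"
  define t0 where "t0 = (\<lambda>v. q0 v $ d)"
  have x0: "x0 \<in> realisations d V" by (simp add: x0_def realisations_def)
  have x0a: "x0 a = 0\<^sub>v d"
    using apex by (intro eq_vecI) (simp_all add: x0_def q0a vec_first_def pole_index)
  have x0_diff: "x0 v - x0 a = vec_first (q0 v) d" if "v \<in> V" for v
    using realisations_carrier[OF x0 that] that by (simp add: x0a) (simp add: x0_def)
  note q0_eq = suspension_of_projection[OF q0 q0a x0_diff, folded t0_def]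
  \<comment> \<open>The transpose of \<open>M\<close> applied to the suspension of \<open>x\<close>, with the apex at height \<open>1\<close>. It is written
    in coordinates so that the coordinates are polynomial also where \<open>x\<close> is not a realisation.\<close>
  define \<sigma> where "\<sigma> = (\<lambda>s. \<lambda>v\<in>V. vec (Suc d) (\<lambda>i.
    (\<Sum>j<d. M $$ (j, i) * (fst s v $ j - fst s a $ j)) +
    M $$ (d, i) * (if v = a then 1 else snd s v)))"
  have \<sigma>_eq: "\<sigma> (x, t) = (\<lambda>v\<in>V. M\<^sup>T *\<^sub>v suspension V a x (t(a := 1)) v)"
    if x: "x \<in> realisations d V" for x :: "'v \<Rightarrow> complex vec" and t
  proof
    fix v
    show "\<sigma> (x, t) v = (\<lambda>v\<in>V. M\<^sup>T *\<^sub>v suspension V a x (t(a := 1)) v) v"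
    proof (cases "v \<in> V")
      case True
      have c: "x v \<in> carrier_vec d" "x a \<in> carrier_vec d" "x v - x a \<in> carrier_vec d"
        using realisations_carrier[OF x] True apex by auto
      show ?thesis
        using True c Mc
        by (intro eq_vecI)
          (auto simp: \<sigma>_def suspension_def scalar_prod_def sum.atLeast0_lessThan_Suc
            snoc_index[OF c(3)] atLeast0LessThan)
    qed (simp add: \<sigma>_def)
  qed
  let ?P = "polynomial_functions d V"
  note P = function_algebra_polynomial_functions[of d V]
  note R = function_algebra_mixed[OF P, of "V - {a}"]
  have h: "(\<lambda>s. f (\<sigma> s)) \<in> mixed_polynomials ?P (V - {a})"
  proof (rule polynomial_substitution[OF R f])
    fix v i assume v: "v \<in> V" and i: "i < Suc d"
    have base: "(\<lambda>s. fst s u $ j) \<in> mixed_polynomials ?P (V - {a})" if "u \<in> V" "j < d" for u j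
      using mixed_polynomials.base[OF polynomial_functions.coord[OF that]] .
    have "(\<lambda>s. if v = a then 1 else snd s v) \<in> mixed_polynomials ?P (V - {a})"
      using v by (cases "v = a") (auto intro: algebra_const[OF R] mixed_polynomials.root)
    then have "(\<lambda>s. (\<Sum>j<d. M $$ (j, i) * (fst s v $ j - fst s a $ j)) +
        M $$ (d, i) * (if v = a then 1 else snd s v)) \<in> mixed_polynomials ?P (V - {a})"
      using v apex
      by (intro algebra_add[OF R] algebra_mult[OF R] algebra_sum[OF R] algebra_diff[OF R]
          algebra_const[OF R] base) auto
    then show "(\<lambda>s. \<sigma> s v $ i) \<in> mixed_polynomials ?P (V - {a})"
      using v i by (simp add: \<sigma>_def)
  qed
  define c where "c = (\<lambda>v (x :: 'v \<Rightarrow> complex vec). 1 - (\<Sum>i<d. (x v $ i - x a $ i)\<^sup>2))"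
  have c: "c v \<in> ?P" if "v \<in> V" for v
    unfolding c_def using that apex
    by (intro polynomial_diff polynomial_const polynomial_sum polynomial_power
        polynomial_functions.coord) auto
  have c_eq: "c v x = 1 - sqn (x v - x a)" if "x \<in> realisations d V" "v \<in> V" for v x
    using realisations_carrier[OF that] realisations_carrier[OF that(1) apex]
    by (simp add: c_def sqn_def scalar_prod_def power2_eq_square atLeast0LessThan)
  have fin: "finite (V - {a})" using graph by (simp add: finite_simple_graph_def)
  have "\<sigma> (x0, t0) = p0"
  proof
    fix v
    have "t0(a := 1) = t0" using q0_eq(3) by (intro fun_upd_idem) (simp add: t0_def)
    then show "\<sigma> (x0, t0) v = p0 v"
      using \<sigma>_eq[OF x0, of t0] q0_eq(1) orthogonal_transpose_cancel(1)[OF M]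
        spherical_realisations_carrier[OF p0] p0
      by (cases "v \<in> V") (auto simp: q0_def spherical_realisations_def)
  qed
  then have h0: "f (\<sigma> (x0, t0)) \<noteq> 0" using f0 by simp
  have "(t0 v)\<^sup>2 = c v x0" if "v \<in> V - {a}" for v
    using q0_eq(2) c_eq[OF x0] that by (simp add: is_height_def)
  with eliminate_square_roots[OF P fin _ h _ h0, of c] c obtain g where g: "g \<in> ?P" "g x0 \<noteq> 0"
    and lift: "\<And>x. g x \<noteq> 0 \<Longrightarrow> \<exists>t. (\<forall>v\<in>V - {a}. (t v)\<^sup>2 = c v x) \<and> f (\<sigma> (x, t)) \<noteq> 0"
    by auto
  have "ecard (realisation_classes d V E x) = k" if x: "x \<in> realisations d V" and gx: "g x \<noteq> 0" for x
  proof -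
    obtain t where t: "\<forall>v\<in>V - {a}. (t v)\<^sup>2 = c v x" and ft: "f (\<sigma> (x, t)) \<noteq> 0"
      using lift[OF gx] by blast
    have "sqn (x a - x a) = 0"
      using realisations_carrier[OF x apex] by (simp add: sqn_def)
    then have height: "is_height V a x (t(a := 1))"
      using t c_eq[OF x] by (simp add: is_height_def)
    let ?S = "suspension V a x (t(a := 1))"
    have S: "?S \<in> spherical_realisations d V" using x height by (rule suspension_spherical)
    have "ecard (realisation_classes d V E x) = ecard (spherical_realisation_classes d V E ?S)"
      using x height by (rule ecard_realisation_classes_suspension) simp
    also have "\<dots> = ecard (spherical_realisation_classes d V E (\<lambda>v\<in>V. M\<^sup>T *\<^sub>v ?S v))"
      using spherical_realisation_classes_orthogonal[OF MT S] by simp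
    also have "\<dots> = k"
      using orthogonal_image_spherical[OF MT S] ft \<sigma>_eq[OF x] by (intro count) simp_all
    finally show ?thesis .
  qed
  with g x0 show ?thesis unfolding holds_generally_iff by blast
qed

text \<open>A spherical realisation is brought into standard position by the reflection that moves its
  apex to the pole, and then projected to \<open>\<complex>\<^sup>d\<close>. Both steps together are a rational map \<open>\<xi>\<close> with denominator
  \<open>D\<close>, along which the polynomial \<open>g\<close> is pulled back.\<close>

lemma generally_spherical_of_euclidean:
  assumes "holds_generally d V (realisations d V) (\<lambda>x. ecard (realisation_classes d V E x) = k)"
  shows "holds_generally (Suc d) V (spherical_realisations d V)
    (\<lambda>p. ecard (spherical_realisation_classes d V E p) = k)"
proof -
  obtain g x0 where g: "g \<in> polynomial_functions d V"
    and x0: "x0 \<in> realisations d V" and g0: "g x0 \<noteq> 0"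
    and count: "\<And>x. x \<in> realisations d V \<Longrightarrow> g x \<noteq> 0 \<Longrightarrow>
      ecard (realisation_classes d V E x) = k"
    using assms unfolding holds_generally_iff by blast
  let ?P = "polynomial_functions (Suc d) V"
  note P = function_algebra_polynomial_functions[of "Suc d" V]
  define D where "D = (\<lambda>p :: 'v \<Rightarrow> complex vec. 1 - p a $ d)"
  define \<kappa> where "\<kappa> = (\<lambda>v (p :: 'v \<Rightarrow> complex vec). \<Sum>j<Suc d. (p a $ j - pole d $ j) * p v $ j)"
  \<comment> \<open>The constant \<open>x0 a\<close> makes \<open>\<xi>\<close> hit \<open>x0\<close> itself and not only a translate of it.\<close>
  define \<xi> where "\<xi> = (\<lambda>p. \<lambda>v\<in>V. vec d (\<lambda>i. p v $ i - \<kappa> v p / D p * p a $ i + x0 a $ i))"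
  have coord: "(\<lambda>p. p v $ i) \<in> ?P" if "v \<in> V" "i < Suc d" for v i
    using that by (rule polynomial_functions.coord)
  have D: "D \<in> ?P"
    unfolding D_def using apex by (intro polynomial_diff polynomial_const coord) auto
  have \<kappa>: "\<kappa> v \<in> ?P" if "v \<in> V" for v
    unfolding \<kappa>_def using apex that
    by (intro polynomial_sum polynomial_mult polynomial_diff polynomial_const coord) auto
  have "(\<lambda>p. g (\<xi> p)) \<in> fractions D ?P"
  proof (rule polynomial_substitution[OF function_algebra_fractions[OF P D] g])
    fix v i assume v: "v \<in> V" and i: "i < d"
    have "(\<lambda>p. D p * (p v $ i + x0 a $ i) - \<kappa> v p * p a $ i) \<in> ?P"
      using v i apex D \<kappa>
      by (intro polynomial_diff polynomial_mult polynomial_add polynomial_const coord) auto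
    moreover have "D p * (p v $ i + x0 a $ i) - \<kappa> v p * p a $ i = D p ^ 1 * \<xi> p v $ i"
      if "D p \<noteq> 0" for p
      using that v i by (simp add: \<xi>_def field_simps)
    ultimately show "(\<lambda>p. \<xi> p v $ i) \<in> fractions D ?P"
      by (rule fractionsI)
  qed
  then obtain m f where f: "f \<in> ?P" and f_eq: "\<And>p. D p \<noteq> 0 \<Longrightarrow> f p = D p ^ m * g (\<xi> p)"
    by (auto simp: fractions_def)
  \<comment> \<open>The extra factor \<open>D\<close> removes the points where the formula for \<open>\<xi>\<close> divides by zero.\<close>
  have Df: "(\<lambda>p. D p * f p) \<in> ?P" using D f by (rule polynomial_mult)
  have \<xi>_real: "\<xi> p \<in> realisations d V" for p
    by (simp add: \<xi>_def realisations_def)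
  have "ecard (spherical_realisation_classes d V E p) = k"
    if p: "p \<in> spherical_realisations d V" and nz: "D p * f p \<noteq> 0" for p
  proof -
    have Dp: "D p \<noteq> 0" and g\<xi>: "g (\<xi> p) \<noteq> 0" using nz f_eq[of p] by auto
    have pa: "p a \<in> complex_sphere d" using p apex by (auto simp: spherical_realisations_def)
    have pc: "p v \<in> carrier_vec (Suc d)" if "v \<in> V" for v
      using p that by (rule spherical_realisations_carrier)
    let ?w = "p a - pole d"
    have wc: "?w \<in> carrier_vec (Suc d)" using pc[OF apex] pole_carrier by auto
    have H: "householder ?w \<in> complex_orthogonal_group (Suc d)"
      and Ha: "householder ?w *\<^sub>v p a = pole d"
      using householder_to_pole[OF pa] Dp by (auto simp: D_def)
    have sq: "sqn ?w = 2 * D p" using sqn_diff_pole[OF pa] by (simp add: D_def)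
    define q where "q = (\<lambda>v\<in>V. householder ?w *\<^sub>v p v)"
    have q: "q \<in> spherical_realisations d V"
      unfolding q_def using H p by (rule orthogonal_image_spherical)
    have qa: "q a = pole d" using Ha apex by (simp add: q_def)
    have q_index: "\<xi> p v $ i = q v $ i + x0 a $ i" if "v \<in> V" "i < d" for v i
    proof -
      have "?w \<bullet> p v = \<kappa> v p"
        using pc[OF that(1)] pc[OF apex] by (simp add: \<kappa>_def scalar_prod_def atLeast0LessThan)
      moreover have "?w $ i = p a $ i"
        using pc[OF apex] that by (simp add: pole_index)
      ultimately have "q v $ i = p v $ i - \<kappa> v p / D p * p a $ i"
        using householder_apply[OF wc pc[OF that(1)], of i] that Dp by (simp add: q_def sq)
      then show ?thesis using that by (simp add: \<xi>_def)
    qed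
    have "dim_vec (\<xi> p v) = d" if "v \<in> V" for v
      using that by (simp add: \<xi>_def)
    then have "\<xi> p v - \<xi> p a = vec_first (q v) d" if "v \<in> V" for v
      using that apex q_index
      by (intro eq_vecI) (auto simp: vec_first_def qa pole_index)
    note q_eq = suspension_of_projection[OF q qa this]
    have "ecard (realisation_classes d V E (\<xi> p)) = ecard (spherical_realisation_classes d V E q)"
      using ecard_realisation_classes_suspension[OF \<xi>_real q_eq(2,3)] q_eq(1) by simp
    also have "\<dots> = ecard (spherical_realisation_classes d V E p)"
      unfolding q_def using spherical_realisation_classes_orthogonal[OF H p] by simp
    finally show ?thesis using count[OF \<xi>_real g\<xi>] by simp
  qed
  moreover have "\<exists>p\<in>spherical_realisations d V. D p * f p \<noteq> 0"
  proof
    \<comment> \<open>The minus sign puts the apex at the antipode of the pole: at the pole \<open>D\<close> vanishes. The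
      reflection is then that in the last coordinate, which only changes the signs of the heights.\<close>
    define t where "t = (\<lambda>v. - csqrt (1 - sqn (x0 v - x0 a)))"
    have x0c: "x0 v \<in> carrier_vec d" if "v \<in> V" for v
      using x0 that by (rule realisations_carrier)
    have "is_height V a x0 t" by (simp add: is_height_def t_def)
    then show p: "suspension V a x0 t \<in> spherical_realisations d V"
      using x0 by (intro suspension_spherical)
    let ?p = "suspension V a x0 t"
    have ta: "t a = - 1" using x0c[OF apex] by (simp add: t_def sqn_def)
    have p_index: "?p v $ i = (if i < d then x0 v $ i - x0 a $ i else t v)" if "v \<in> V" "i < Suc d" for v i
      using that x0c[OF that(1)] x0c[OF apex] snoc_index[of "x0 v - x0 a" d i "t v"]
      by (simp add: suspension_def)
    have Dp: "D ?p = 2" using p_index[OF apex, of d] by (simp add: D_def ta)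
    have "\<xi> ?p = x0"
    proof
      fix v
      show "\<xi> ?p v = x0 v"
      proof (cases "v \<in> V")
        case True
        then show ?thesis
          using x0c[OF True] by (intro eq_vecI) (simp_all add: \<xi>_def Dp p_index apex)
      next
        case False
        then show ?thesis using x0 by (auto simp: \<xi>_def realisations_def)
      qed
    qed
    then show "D ?p * f ?p \<noteq> 0" using f_eq[of ?p] Dp g0 by simp
  qed
  ultimately show ?thesis
    unfolding holds_generally_iff by (intro bexI[OF _ Df] conjI ballI impI) simp_all
qed

text \<open>The two preceding lemmas say that both general values are defined by the same predicate of \<open>k\<close>.\<close>

lemma realisation_number_eq_spherical:
  "realisation_number d V E = spherical_realisation_number d V E"
proof -
  have "holds_generally d V (realisations d V) (\<lambda>x. ecard (realisation_classes d V E x) = k) \<longleftrightarrow>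
      holds_generally (d + 1) V (spherical_realisations d V)
        (\<lambda>p. ecard (spherical_realisation_classes d V E p) = k)" for k
    using generally_spherical_of_euclidean generally_euclidean_of_spherical by auto
  then show ?thesis
    by (simp add: realisation_number_def spherical_realisation_number_def)
qed

end

theorem theorem5p2:
  fixes d :: nat and V :: "'v set" and E :: "'v set set" and a :: 'v
  assumes "d > 0"
    and "finite_simple_graph V E"
    and "a \<notin> V"
  shows "realisation_number d (cone_verts V a) (cone_edges V E a) =
    spherical_realisation_number d (cone_verts V a) (cone_edges V E a)"
proof -
  interpret cone "cone_verts V a" "cone_edges V E a" a
    using assms
    by unfold_locales (auto simp: finite_simple_graph_def cone_verts_def cone_edges_def card_2_iff)
  show ?thesis by (rule realisation_number_eq_spherical)
qed

end
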